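(* Let $n\to\infty$, and let $N=N(n)$ be an integer with $3n\le N\le ne^{2n}$ and $p=p(n)\in(0,1]$. The following hold asymptotically almost surely as $n\to\infty$. (i) If $p\ge \left(\log\frac{N}{n}\right)/(6n)$, then $\frac14 pnN\le \mathrm{ex}(G(N,p),P_{n+1})\le 18pnN$. (ii) Let $\omega=\left(\log\frac{N}{n}\right)/(np)$. If $N^{-1}\le p\le \left(\log\frac{N}{n}\right)/(6n)$, then \[\frac{1}{75}\frac{\omega}{\log\omega}pnN\le \mathrm{ex}(G(N,p),P_{n+1})\le 8\frac{\omega}{\log\omega}pnN.\]
   Context: $G(N,p)$ denotes the Erdős–Rényi random graph on vertex set $[N]$ in which each pair is an edge independently with probability $p$. $P_k$ denotes the path on $k$ vertices. For graphs $G,F$, $\mathrm{ex}(G,F)$ is the maximum number of edges in an $F$-free subgraph of $G$. All logarithms are natural. "Asymptotically almost surely" means with probability tending to $1$ as $n\to\infty$. *)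

theory Defs
  imports "HOL-Probability.Probability"
begin

text \<open>Simple graphs on vertex set {0..<N} are represented by their edge sets,
  edges being 2-element sets of vertices.\<close>

definition all_edges :: "nat \<Rightarrow> nat set set" where
  "all_edges N = {e. \<exists>i j. i < j \<and> j < N \<and> e = {i, j}}"

definition gnp :: "nat \<Rightarrow> real \<Rightarrow> nat set set pmf" where
  "gnp N p = map_pmf (\<lambda>f. {e \<in> all_edges N. f e})
                     (Pi_pmf (all_edges N) False (\<lambda>_. bernoulli_pmf p))"

definition has_path :: "nat set set \<Rightarrow> nat \<Rightarrow> bool" where
  "has_path F k \<longleftrightarrow> (\<exists>xs. length xs = k \<and> distinct xs \<and>
                        (\<forall>i. Suc i < k \<longrightarrow> {xs ! i, xs ! Suc i} \<in> F))"

definition ex_path :: "nat set set \<Rightarrow> nat \<Rightarrow> nat" where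
  "ex_path E k = Max (card ` {F. F \<subseteq> E \<and> \<not> has_path F k})"

end

theory Submission
  imports Defs
begin

text \<open>Upper bounds. Depth-first search shows that in a graph without a path on \<open>n + 1\<close> vertices, some
  \<open>n\<close> vertices \<open>S\<close> have at most \<open>n\<close> neighbours outside \<open>S\<close>, namely vertices on the stack of the search.
  Removing \<open>S\<close> and repeating decomposes the edges into at most \<open>N / n + 1\<close> pieces, each of
  which lies in one of the sets of at most \<open>3 / 2 n\<^sup>2\<close> pairs determined by two \<open>n\<close>-sets. There are at
  most \<open>(e N / n)\<^bsup>2n\<^esup>\<close> such sets of pairs, few enough for a union bound. For small \<open>N / n\<close> in part (i)
  the number of all edges already suffices.

  Lower bounds. In part (i), take all edges inside disjoint vertex sets of size \<open>n\<close>. In part (ii), take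
  \<open>N div n\<close> disjoint sets of fewer than \<open>n / 2\<close> vertices and join each remaining vertex to a set in
  which it has at least \<open>d\<close> neighbours; the subgraph is path-free since each component has a vertex
  cover of size less than \<open>n / 2\<close>. With \<open>L = ln (N / n)\<close> and \<open>d\<close> a small
  multiple of \<open>L / ln \<omega>\<close>, a given set works with probability at least \<open>e\<^bsup>-L/2\<^esup>\<close>, and there are
  about \<open>e\<^bsup>L\<^esup>\<close> sets to choose from. Chebyshev's inequality gives concentration in both parts.\<close>

subsection \<open>Path-free graphs\<close>

text \<open>A state of depth-first search: \<open>X\<close> is the set of finished vertices and \<open>P\<close> the stack, top first.\<close>

lemma small_boundary_set_exists:
  assumes "finite V" "s \<le> card V" and np: "\<not> has_path F (Suc n)"
    and dist: "distinct P" and X: "X \<subseteq> V - set P" and P: "set P \<subseteq> V"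
    and adj: "\<And>i. Suc i < length P \<Longrightarrow> {P ! i, P ! Suc i} \<in> F"
    and sep: "\<And>x y. x \<in> X \<Longrightarrow> y \<in> V \<Longrightarrow> {x, y} \<in> F \<Longrightarrow> y \<in> X \<union> set P"
    and cX: "card X \<le> s"
  shows "\<exists>S A. S \<subseteq> V \<and> card S = s \<and> A \<subseteq> V - S \<and> card A \<le> n \<and>
           (\<forall>x\<in>S. \<forall>y\<in>V. {x, y} \<in> F \<longrightarrow> y \<in> S \<union> A)"
  using dist X P adj sep cX
\<comment> \<open>Pushing a new vertex lowers the first summand by at least 2 and raises the second
  by 1; popping keeps the first and lowers the second. So each step of the search decreases this
  measure.\<close>
proof (induction "2 * card (V - X - set P) + length P" arbitrary: X P rule: less_induct)
  case less
  note IH = less.hyps and dist = less.prems(1) and X = less.prems(2) and P = less.prems(3)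
    and adj = less.prems(4) and sep = less.prems(5) and cX = less.prems(6)
  have finX: "finite X" using X assms(1) by (meson Diff_subset finite_subset subset_trans)
  \<comment> \<open>The stack is itself a path in \<open>F\<close>, so it holds at most
    \<open>n\<close> vertices.\<close>
  have lenP: "length P \<le> n"
  proof (rule ccontr)
    assume "\<not> length P \<le> n"
    then have "has_path F (Suc n)" unfolding has_path_def
      using dist adj by (intro exI[of _ "take (Suc n) P"]) auto
    then show False using np by simp
  qed
  show ?case
  \<comment> \<open>The search stops once \<open>s\<close> vertices are finished: by
    \<open>sep\<close>, their neighbours in \<open>V\<close> outside \<open>X\<close> are then on
    the stack. Vertices finish one at a time, so the size \<open>s\<close> is not skipped.\<close>
  proof (cases "card X = s")
    case True
    then show ?thesis
      using X P sep lenP dist by (intro exI[of _ X] exI[of _ "set P"]) (auto simp: distinct_card)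
  next
    case False
    then have cX': "card X < s" using cX by simp
    show ?thesis
    proof (cases P)
      case Nil
      \<comment> \<open>An empty stack with fewer than \<open>s\<close> finished vertices: the
        search restarts at an unvisited vertex.\<close>
      have "\<not> V \<subseteq> X"
        using cX' assms(1,2) card_mono finX by (metis leD le_trans)
      then obtain v where v: "v \<in> V" "v \<notin> X" by auto
      have "card (V - X - {v}) < card (V - X)"
        using v assms(1) by (intro psubset_card_mono) auto
      then show ?thesis
        using v X sep cX Nil by (intro IH[of X "[v]"]) auto
    next
      case (Cons v Q)
      show ?thesis
      proof (cases "\<exists>y\<in>V - X - set P. {v, y} \<in> F")
        case True
        then obtain y where y: "y \<in> V - X - set P" "{v, y} \<in> F" by auto
        have lt: "card (V - X - set (y # P)) < card (V - X - set P)"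
          using y assms(1) by (intro psubset_card_mono) auto
        show ?thesis
        proof (rule IH[of X "y # P"])
          show "2 * card (V - X - set (y # P)) + length (y # P) < 2 * card (V - X - set P) + length P"
            using lt by simp
          show "{(y # P) ! i, (y # P) ! Suc i} \<in> F" if "Suc i < length (y # P)" for i
            using that adj y Cons by (cases i) (auto simp: insert_commute)
          show "y' \<in> X \<union> set (y # P)" if "x \<in> X" "y' \<in> V" "{x, y'} \<in> F" for x y'
            using sep[OF that] by auto
        qed (use y dist X P cX in auto)
      next
        case False
        \<comment> \<open>The top \<open>v\<close> has no unvisited neighbour, so declaring it
          finished preserves \<open>sep\<close>.\<close>
        have "V - insert v X - set Q = V - X - set P" using Cons by auto
        moreover have "{Q ! i, Q ! Suc i} \<in> F" if "Suc i < length Q" for i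
          using adj[of "Suc i"] that Cons by simp
        moreover have "y \<in> insert v X \<union> set Q"
          if "x \<in> insert v X" "y \<in> V" "{x, y} \<in> F" for x y
          using that sep[of x y] False Cons by auto
        moreover have "card (insert v X) \<le> s"
          using cX' finX by (simp add: card_insert_if)
        ultimately show ?thesis
          using dist X P Cons by (intro IH[of "insert v X" Q]) auto
      qed
    qed
  qed
qed

text \<open>When \<open>A\<close> contains all neighbours of \<open>S\<close> outside
  \<open>S\<close>, these are the edges lost by deleting \<open>S\<close>. The two sets may overlap,
  so each can be enlarged independently to a prescribed size.\<close>

definition touching :: "nat \<Rightarrow> nat set \<Rightarrow> nat set \<Rightarrow> nat set set" where
  "touching N S A = {e \<in> all_edges N. e \<subseteq> S \<union> A \<and> e \<inter> S \<noteq> {}}"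

lemma all_edges_alt: "all_edges N = {e. e \<subseteq> {..<N} \<and> card e = 2}"
proof (intro equalityI subsetI)
  fix e assume "e \<in> {e. e \<subseteq> {..<N} \<and> card e = 2}"
  then obtain x y where e: "e = {x, y}" "x \<noteq> y" "x < N" "y < N" by (auto simp: card_2_iff)
  show "e \<in> all_edges N"
  proof (cases "x < y")
    case False
    then have "y < x" "e = {y, x}" using e by auto
    then show ?thesis using e unfolding all_edges_def by blast
  qed (use e in \<open>auto simp: all_edges_def\<close>)
qed (auto simp: all_edges_def)

lemma finite_all_edges [simp]: "finite (all_edges N)"
  unfolding all_edges_alt by (rule finite_subset[of _ "Pow {..<N}"]) auto

lemma card_all_edges: "card (all_edges N) = N choose 2"
  unfolding all_edges_alt by (simp add: n_subsets)

lemma pair_mem_all_edges [simp]: "{x, y} \<in> all_edges N \<longleftrightarrow> x \<noteq> y \<and> x < N \<and> y < N"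
  by (auto simp: all_edges_alt card_2_iff card_insert_if)

lemma finite_touching [simp]: "finite (touching N S A)"
  unfolding touching_def by simp

text \<open>There are at most \<open>n choose 2\<close> edges inside \<open>S\<close> and
  \<open>n * n\<close> between \<open>S\<close> and \<open>A\<close>.\<close>

lemma card_touching_le:
  assumes "finite S" "finite A" "card S = n" "card A = n"
  shows "real (card (touching N S A)) \<le> 3 / 2 * real n ^ 2"
proof -
  have sub: "touching N S A \<subseteq> {e. e \<subseteq> S \<and> card e = 2} \<union> (\<lambda>(x, y). {x, y}) ` (S \<times> A)"
  proof
    fix e assume e: "e \<in> touching N S A"
    then obtain x y where "e = {x, y}" "x \<noteq> y" "x \<in> S \<or> y \<in> S" "x \<in> S \<union> A" "y \<in> S \<union> A"
      unfolding touching_def all_edges_alt by (auto simp: card_2_iff)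
    then show "e \<in> {e. e \<subseteq> S \<and> card e = 2} \<union> (\<lambda>(x, y). {x, y}) ` (S \<times> A)"
      by (fastforce simp: card_2_iff insert_commute image_iff)
  qed
  have "card (touching N S A) \<le> card ({e. e \<subseteq> S \<and> card e = 2} \<union> (\<lambda>(x, y). {x, y}) ` (S \<times> A))"
    using assms by (intro card_mono sub) auto
  also have "\<dots> \<le> card {e. e \<subseteq> S \<and> card e = 2} + card (S \<times> A)"
    using assms by (intro order_trans[OF card_Un_le] add_mono card_image_le) auto
  also have "\<dots> = (n choose 2) + n * n"
    using assms by (simp add: n_subsets card_cartesian_product)
  finally have "card (touching N S A) \<le> (n choose 2) + n * n" .
  moreover have "2 * (n choose 2) \<le> n * n"
    using times_div_less_eq_dividend[of 2 "n * (n - 1)"] diff_le_self[of n 1]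
    unfolding choose_two by (meson le_trans mult_le_mono2)
  ultimately have "2 * card (touching N S A) \<le> 3 * (n * n)" by linarith
  then have "real (2 * card (touching N S A)) \<le> real (3 * (n * n))" by (rule of_nat_mono)
  then show ?thesis by (simp add: power2_eq_square)
qed

lemma has_path_mono: "has_path F k \<Longrightarrow> F \<subseteq> G \<Longrightarrow> has_path G k"
  unfolding has_path_def by blast

text \<open>Induction on \<open>t\<close>: deleting the set \<open>S\<close> found by depth-first
  search loses only edges of one \<open>touching\<close> set, hence at most \<open>x\<close>, and
  leaves a vertex set small enough for \<open>t\<close> blocks. Path-freeness and the bound
  \<open>x\<close> pass to subgraphs, so \<open>F\<close> and \<open>V\<close> shrink
  together.\<close>

lemma card_path_free_le_blocks:
  assumes "n > 0" "F \<subseteq> all_edges N" "\<not> has_path F (Suc n)"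
    and bound: "\<And>S A. S \<subseteq> {..<N} \<Longrightarrow> A \<subseteq> {..<N} \<Longrightarrow> card S \<le> n \<Longrightarrow> card A \<le> n \<Longrightarrow>
                  real (card (F \<inter> touching N S A)) \<le> x"
    and "V \<subseteq> {..<N}" "card V \<le> t * n" "\<And>e. e \<in> F \<Longrightarrow> e \<subseteq> V"
  shows "real (card F) \<le> real t * x"
  using assms(2-)
proof (induction t arbitrary: V F)
  case 0
  then have "V = {}" using finite_subset[OF 0(4)] by simp
  have "F = {}"
  proof (rule ccontr)
    assume "F \<noteq> {}"
    then obtain e where "e \<in> F" by blast
    then show False using 0(1) 0(6)[of e] \<open>V = {}\<close> by (auto simp: all_edges_alt)
  qed
  then show ?case by simp
next
  case (Suc t)
  note FE = Suc.prems(1) and np = Suc.prems(2) and bd = Suc.prems(3) and V = Suc.prems(4)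
    and cV = Suc.prems(5) and FV = Suc.prems(6)
  have finV: "finite V" using V finite_subset by blast
  have finF: "finite F" by (rule finite_subset[OF FE finite_all_edges])
  \<comment> \<open>The minimum covers a last block with fewer than \<open>n\<close> vertices
    left.\<close>
  define s where "s = min n (card V)"
  obtain S A where S: "S \<subseteq> V" "card S = s" "A \<subseteq> V - S" "card A \<le> n"
    and nb: "\<And>u v. u \<in> S \<Longrightarrow> v \<in> V \<Longrightarrow> {u, v} \<in> F \<Longrightarrow> v \<in> S \<union> A"
    using small_boundary_set_exists[of V s F n "[]" "{}"] finV np by (auto simp: s_def)
  define F' where "F' = {e \<in> F. e \<inter> S = {}}"
  have F': "F' \<subseteq> F" by (auto simp: F'_def)
  have "F \<subseteq> F' \<union> (F \<inter> touching N S A)"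
  proof
    fix e assume e: "e \<in> F"
    obtain u v where uv: "e = {u, v}" using e FE by (auto simp: all_edges_def)
    have "u \<in> V" "v \<in> V" using FV[OF e] uv by auto
    then have "e \<inter> S \<noteq> {} \<longrightarrow> e \<subseteq> S \<union> A"
      using nb[of u v] nb[of v u] e uv by (auto simp: insert_commute)
    then show "e \<in> F' \<union> (F \<inter> touching N S A)"
      using e FE by (auto simp: F'_def touching_def)
  qed
  then have "card F \<le> card F' + card (F \<inter> touching N S A)"
    using finF F' by (intro order_trans[OF card_mono card_Un_le]) (auto intro: finite_subset)
  moreover have "real (card (F \<inter> touching N S A)) \<le> x"
    using S V by (intro bd) (auto simp: s_def)
  moreover have "real (card F') \<le> real t * x"
  proof (rule Suc.IH)
    show "F' \<subseteq> all_edges N" using F' FE by blast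
    show "\<not> has_path F' (Suc n)" using F' np has_path_mono by blast
    show "V - S \<subseteq> {..<N}" using V by auto
    have "card (V - S) = card V - s" using S finV by (simp add: card_Diff_subset finite_subset)
    then show "card (V - S) \<le> t * n" using cV by (auto simp: s_def min_def)
    show "e \<subseteq> V - S" if "e \<in> F'" for e using that FV by (auto simp: F'_def)
    fix S' A' assume *: "S' \<subseteq> {..<N}" "A' \<subseteq> {..<N}" "card S' \<le> n" "card A' \<le> n"
    have "card (F' \<inter> touching N S' A') \<le> card (F \<inter> touching N S' A')"
      using F' by (intro card_mono) auto
    with bd[OF *] show "real (card (F' \<inter> touching N S' A')) \<le> x" by linarith
  qed
  ultimately show ?case by (simp add: algebra_simps)
qed

text \<open>For \<open>k > 1\<close> the empty graph is path-free, so the maximum is over a nonempty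
  set and is attained.\<close>

lemma ex_path_witness:
  assumes "finite E" "k > 1"
  obtains F where "F \<subseteq> E" "\<not> has_path F k" "card F = ex_path E k"
proof -
  have "\<not> has_path {} k" using assms by (auto simp: has_path_def intro!: exI[of _ 0])
  then have "card ` {F. F \<subseteq> E \<and> \<not> has_path F k} \<noteq> {}" by blast
  moreover have "finite (card ` {F. F \<subseteq> E \<and> \<not> has_path F k})"
    using assms by simp
  ultimately have "ex_path E k \<in> card ` {F. F \<subseteq> E \<and> \<not> has_path F k}"
    unfolding ex_path_def by (intro Max_in)
  then show ?thesis using that by force
qed

lemma card_le_ex_path:
  assumes "finite E" "F \<subseteq> E" "\<not> has_path F k"
  shows "card F \<le> ex_path E k"
  unfolding ex_path_def using assms by (intro Max_ge) auto

text \<open>Padding smaller sets to exactly \<open>n\<close> vertices reduces the hypothesis to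
  pairs of \<open>n\<close>-sets, the family over which the union bound will run.\<close>

lemma ex_path_le_blocks:
  assumes "n > 0" "n \<le> N" "E \<subseteq> all_edges N" "x \<ge> 0"
    and bound: "\<And>S A. S \<subseteq> {..<N} \<Longrightarrow> A \<subseteq> {..<N} \<Longrightarrow> card S = n \<Longrightarrow> card A = n \<Longrightarrow>
                  real (card (E \<inter> touching N S A)) \<le> x"
  shows "real (ex_path E (n + 1)) \<le> (real N / real n + 1) * x"
proof -
  have fE: "finite E" by (rule finite_subset[OF assms(3) finite_all_edges])
  obtain F where F: "F \<subseteq> E" "\<not> has_path F (n + 1)" "card F = ex_path E (n + 1)"
    using ex_path_witness[OF fE, of "n + 1"] assms(1) by auto
  have pad: "\<exists>T'. T \<subseteq> T' \<and> T' \<subseteq> {..<N} \<and> card T' = n" if "T \<subseteq> {..<N}" "card T \<le> n" for T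
    using exists_subset_between[of T n "{..<N}"] that assms(2) by auto
  have "real (card F) \<le> real (N div n + 1) * x"
  proof (rule card_path_free_le_blocks[of n F N x "{..<N}" "N div n + 1"])
    show "card {..<N} \<le> (N div n + 1) * n"
      using dividend_less_div_times[OF assms(1), of N] by simp
    fix S A assume *: "S \<subseteq> {..<N}" "A \<subseteq> {..<N}" "card S \<le> n" "card A \<le> n"
    obtain S' where S': "S \<subseteq> S'" "S' \<subseteq> {..<N}" "card S' = n" using pad * by blast
    obtain A' where A': "A \<subseteq> A'" "A' \<subseteq> {..<N}" "card A' = n" using pad * by blast
    have "card (F \<inter> touching N S A) \<le> card (E \<inter> touching N S' A')"
      using S' A' F by (intro card_mono) (auto simp: touching_def)
    with bound[OF S'(2) A'(2) S'(3) A'(3)] show "real (card (F \<inter> touching N S A)) \<le> x" by linarith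
  qed (use F assms in \<open>auto simp: all_edges_alt\<close>)
  also have "\<dots> \<le> (real N / real n + 1) * x"
    using of_nat_div_le_of_nat[of N n] assms(4) by (intro mult_right_mono) auto
  finally show ?thesis using F by simp
qed

section \<open>Sufficient conditions for path-freeness\<close>

lemma path_constant:
  assumes "\<And>u v. {u, v} \<in> F \<Longrightarrow> c u = c v"
    and "\<And>i. Suc i < length xs \<Longrightarrow> {xs ! i, xs ! Suc i} \<in> F" "i < length xs"
  shows "c (xs ! i) = c (xs ! 0)"
  using assms(3)
proof (induction i)
  case (Suc i)
  then show ?case using assms(1)[OF assms(2)[of i]] by simp
qed simp

text \<open>The block number is constant along a path, and a block has only \<open>n\<close>
  vertices.\<close>

lemma no_path_in_blocks:
  assumes "n > 0" "F \<subseteq> all_edges N" "\<And>u v. {u, v} \<in> F \<Longrightarrow> u div n = v div n"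
  shows "\<not> has_path F (n + 1)"
proof
  assume "has_path F (n + 1)"
  then obtain xs where xs: "length xs = n + 1" "distinct xs"
    "\<And>i. Suc i < length xs \<Longrightarrow> {xs ! i, xs ! Suc i} \<in> F"
    by (auto simp: has_path_def)
  define b where "b = xs ! 0 div n"
  have "u \<in> {b * n..<b * n + n}" if u: "u \<in> set xs" for u
  proof -
    obtain i where "i < length xs" "xs ! i = u" using u by (auto simp: in_set_conv_nth)
    then have "u div n = b"
      using path_constant[of F "\<lambda>v. v div n" xs i] assms(3) xs by (auto simp: b_def)
    then show ?thesis
      using div_times_less_eq_dividend[of u n] dividend_less_div_times[OF assms(1), of u] by simp
  qed
  then have "card (set xs) \<le> card {b * n..<b * n + n}" by (intro card_mono) auto
  then show False using xs by (simp add: distinct_card)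
qed

text \<open>Every edge of such a path has an endpoint among the at most \<open>a\<close> vertices of one class
  below \<open>m\<close>, so these vertices cover at least half of the path.\<close>

lemma no_path_if_small_vertex_covers:
  assumes "a > 0" "2 * a + 1 \<le> n"
    and lo: "\<And>u v. {u, v} \<in> F \<Longrightarrow> u < m \<or> v < m"
    and col: "\<And>u v. {u, v} \<in> F \<Longrightarrow> c u = c v"
    and cls: "\<And>u. u < m \<Longrightarrow> c u = u div a"
  shows "\<not> has_path F (n + 1)"
proof
  assume "has_path F (n + 1)"
  then obtain xs where xs: "length xs = n + 1" "distinct xs"
    "\<And>i. Suc i < length xs \<Longrightarrow> {xs ! i, xs ! Suc i} \<in> F"
    by (auto simp: has_path_def)
  define b where "b = c (xs ! 0)"
  \<comment> \<open>The positions \<open>2 * j\<close> and \<open>2 * j + 1\<close> for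
    \<open>j <= a\<close> form \<open>a + 1\<close> disjoint pairs of neighbours on the path; they
    fit because \<open>2 * a + 1 <= n\<close>. In each pair \<open>g\<close> picks an endpoint below
    \<open>m\<close>, which gives \<open>a + 1\<close> distinct vertices in a class of
    \<open>a\<close>.\<close>
  define g where "g j = (if xs ! (2 * j) < m then 2 * j else 2 * j + 1)" for j
  have g: "g j < n + 1 \<and> xs ! g j < m" if "j \<le> a" for j
    using lo[OF xs(3)[of "2 * j"]] that assms(2) xs(1) by (auto simp: g_def)
  have "xs ! g j \<in> {b * a..<b * a + a}" if "j \<le> a" for j
  proof -
    have "c (xs ! g j) = b"
      using path_constant[of F c xs "g j"] col xs g[OF that] by (auto simp: b_def)
    then have "(xs ! g j) div a = b" using cls g[OF that] by simp
    then show ?thesis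
      using div_times_less_eq_dividend[of "xs ! g j" a] dividend_less_div_times[OF assms(1), of "xs ! g j"]
      by simp
  qed
  moreover have "inj_on (\<lambda>j. xs ! g j) {..a}"
  proof (rule inj_onI)
    fix i j assume "i \<in> {..a}" "j \<in> {..a}" "xs ! g i = xs ! g j"
    then have "g i = g j" using g xs nth_eq_iff_index_eq[of xs "g i" "g j"] by auto
    moreover have "g k div 2 = k" for k by (simp add: g_def)
    ultimately show "i = j" by metis
  qed
  ultimately have "card {..a} \<le> card {b * a..<b * a + a}"
    by (intro card_inj_on_le[of "\<lambda>j. xs ! g j"]) auto
  then show False by simp
qed

subsection \<open>Independent coin flips\<close>

abbreviation coins :: "'a set \<Rightarrow> real \<Rightarrow> ('a \<Rightarrow> bool) pmf" where
  "coins I p \<equiv> Pi_pmf I False (\<lambda>_. bernoulli_pmf p)"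

section \<open>Upper tail of the number of successes\<close>

lemma prob_coins_all:
  assumes "finite I" "K \<subseteq> I" "0 \<le> p" "p \<le> 1"
  shows "measure_pmf.prob (coins I p) {f. \<forall>e\<in>K. f e} = p ^ card K"
proof -
  have "{f. \<forall>e\<in>K. f e} = Pi I (\<lambda>e. if e \<in> K then {True} else UNIV)"
    using assms(2) by (auto simp: Pi_def split: if_splits)
  moreover have "(\<Prod>e\<in>I. measure_pmf.prob (bernoulli_pmf p) (if e \<in> K then {True} else UNIV)) =
      (\<Prod>e\<in>I. if e \<in> K then p else 1)"
    using assms by (intro prod.cong) (auto simp: measure_pmf_single)
  moreover have "\<dots> = p ^ card K"
    using assms by (simp add: prod.If_cases Int_absorb1)
  ultimately show ?thesis
    using assms(1) by (simp add: measure_Pi_pmf_Pi)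
qed

text \<open>A single term of the exponential series at \<open>k\<close> is at most the whole
  sum.\<close>

lemma power_le_exp_times_fact: "real k ^ k \<le> exp (real k) * fact k"
proof -
  have "(\<Sum>n\<in>{k}. real k ^ n /\<^sub>R fact n) \<le> (\<Sum>n. real k ^ n /\<^sub>R fact n)"
    by (intro sum_le_suminf summable_exp_generic) auto
  then show ?thesis by (simp add: exp_def field_simps)
qed

lemma binomial_le_exp_power:
  assumes "k > 0"
  shows "real (m choose k) \<le> (exp 1 * real m / real k) ^ k"
proof -
  have fact: "real (m choose k) * fact k \<le> real m ^ k"
    using of_nat_mono[OF binomial_fact_pow[of m k], where 'a = real] by simp
  have "real (m choose k) * real k ^ k \<le> real (m choose k) * (exp (real k) * fact k)"
    by (intro mult_left_mono power_le_exp_times_fact) simp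
  also have "\<dots> = (real (m choose k) * fact k) * exp (real k)" by simp
  also have "\<dots> \<le> real m ^ k * exp (real k)" by (intro mult_right_mono fact) simp
  finally have "real (m choose k) * real k ^ k \<le> real m ^ k * exp 1 ^ k"
    by (simp flip: exp_of_nat_mult)
  then show ?thesis using assms by (simp add: power_divide power_mult_distrib field_simps)
qed

text \<open>Union bound over the \<open>k\<close>-subsets of \<open>J\<close> whose coins all
  succeed, where \<open>k\<close> is \<open>x\<close> rounded up. The assumption
  \<open>exp 1 * m * p <= x\<close> keeps the base at most 1, so the exponent \<open>k\<close> may
  be lowered to the real number \<open>x\<close>.\<close>

lemma prob_coins_upper_tail:
  assumes "finite I" "J \<subseteq> I" "0 \<le> p" "p \<le> 1" "real (card J) \<le> m"
    and x: "0 < x" "exp 1 * m * p \<le> x"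
  shows "measure_pmf.prob (coins I p) {f. x \<le> real (card {e\<in>J. f e})} \<le> (exp 1 * m * p / x) powr x"
proof -
  define k where "k = nat \<lceil>x\<rceil>"
  have k: "k > 0" "x \<le> real k" using x(1) by (auto simp: k_def)
  have m: "0 \<le> m" using assms(5) by linarith
  have fJ: "finite J" using assms(1,2) finite_subset by blast
  define D where "D = {K. K \<subseteq> J \<and> card K = k}"
  have fD: "finite D" using fJ by (simp add: D_def)
  have "{f. x \<le> real (card {e\<in>J. f e})} \<subseteq> (\<Union>K\<in>D. {f. \<forall>e\<in>K. f e})"
  proof
    fix f assume "f \<in> {f. x \<le> real (card {e\<in>J. f e})}"
    then have "k \<le> card {e\<in>J. f e}" using k by (simp add: k_def)
    then obtain K where "K \<subseteq> {e\<in>J. f e}" "card K = k" by (meson obtain_subset_with_card_n)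
    then show "f \<in> (\<Union>K\<in>D. {f. \<forall>e\<in>K. f e})" by (auto simp: D_def)
  qed
  then have "measure_pmf.prob (coins I p) {f. x \<le> real (card {e\<in>J. f e})} \<le>
      measure_pmf.prob (coins I p) (\<Union>K\<in>D. {f. \<forall>e\<in>K. f e})"
    by (intro measure_pmf.finite_measure_mono) auto
  also have "\<dots> \<le> (\<Sum>K\<in>D. measure_pmf.prob (coins I p) {f. \<forall>e\<in>K. f e})"
    using fD by (intro measure_pmf.finite_measure_subadditive_finite) auto
  also have "\<dots> = (\<Sum>K\<in>D. p ^ k)"
    using assms(1-4) by (intro sum.cong refl) (subst prob_coins_all, auto simp: D_def)
  also have "\<dots> = real (card J choose k) * p ^ k"
    using fJ by (simp add: D_def n_subsets)
  also have "\<dots> \<le> (exp 1 * real (card J) / real k) ^ k * p ^ k"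
    using assms(3) k by (intro mult_right_mono binomial_le_exp_power) auto
  also have "\<dots> = (exp 1 * real (card J) * p / real k) ^ k"
    by (simp add: power_mult_distrib power_divide)
  also have "\<dots> \<le> (exp 1 * m * p / x) ^ k"
    using k x assms(3,5) by (intro power_mono frac_le mult_mono divide_nonneg_nonneg) auto
  also have "\<dots> \<le> (exp 1 * m * p / x) powr x"
  proof (cases "exp 1 * m * p / x = 0")
    case False
    then have "0 < exp 1 * m * p / x"
      using m x assms(3) by (metis exp_ge_zero divide_nonneg_pos less_eq_real_def mult_nonneg_nonneg)
    then show ?thesis
      using k x by (subst powr_realpow[symmetric]) (auto intro!: powr_mono' simp: divide_le_eq_1)
  next
    \<comment> \<open>A zero base is treated apart, since rewriting the integer power as
      \<open>powr\<close> needs a positive base.\<close>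
    case True
    then show ?thesis using k(1) unfolding True by (simp add: power_0_left)
  qed
  finally show ?thesis .
qed

section \<open>Events on disjoint sets of coins\<close>

lemma measure_pair_pmf_Times:
  "measure_pmf.prob (pair_pmf M N) (A \<times> B) = measure_pmf.prob M A * measure_pmf.prob N B"
proof -
  \<comment> \<open>The product rule used below is for countable sets, hence the restriction to the
    supports.\<close>
  have "measure_pmf.prob (pair_pmf M N) (A \<times> B) =
      measure_pmf.prob (pair_pmf M N) ((A \<inter> set_pmf M) \<times> (B \<inter> set_pmf N))"
    by (subst measure_Int_set_pmf[symmetric]) (auto intro!: arg_cong[where f = "measure_pmf.prob _"])
  also have "\<dots> = measure_pmf.prob M (A \<inter> set_pmf M) * measure_pmf.prob N (B \<inter> set_pmf N)"
    by (intro measure_pmf_prob_product countable_Int2 countable_set_pmf)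
  finally show ?thesis by (simp add: measure_Int_set_pmf)
qed

text \<open>A pointwise substitute for measurability with respect to the coins in \<open>B\<close>;
  it is convenient because closure under complement and intersection is immediate.\<close>

definition depends_on :: "('a \<Rightarrow> bool) set \<Rightarrow> 'a set \<Rightarrow> bool" where
  "depends_on Q B \<longleftrightarrow> (\<forall>f g. (\<forall>e\<in>B. f e = g e) \<longrightarrow> (f \<in> Q \<longleftrightarrow> g \<in> Q))"

text \<open>The coins split into an independent pair, those in \<open>B\<close> and those in
  \<open>I - B\<close>, glued by \<open>h\<close>. Then \<open>Q\<close> looks only at the first
  component and \<open>R\<close>, as \<open>C\<close> misses \<open>B\<close>, only at the
  second.\<close>

lemma prob_coins_indep:
  assumes "finite I" "B \<subseteq> I" "C \<subseteq> I" "B \<inter> C = {}" "depends_on Q B" "depends_on R C"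
  shows "measure_pmf.prob (coins I p) (Q \<inter> R) =
           measure_pmf.prob (coins I p) Q * measure_pmf.prob (coins I p) R"
proof -
  define h where "h = (\<lambda>f g x. if x \<in> B then f x else g x :: bool)"
  let ?M = "coins B p" and ?N = "coins (I - B) p"
  have eq: "coins I p = map_pmf (\<lambda>(f, g). h f g) (pair_pmf ?M ?N)"
    using Pi_pmf_union[of B "I - B" False "\<lambda>_. bernoulli_pmf p"] assms(1,2)
    by (simp add: finite_subset Un_absorb1 h_def)
  have Q: "h f g \<in> Q \<longleftrightarrow> f \<in> Q" for f g
    using assms(5)[unfolded depends_on_def, rule_format, of "h f g" f] by (simp add: h_def)
  have "\<forall>e\<in>C. h f g e = g e" for f g using assms(4) by (auto simp: h_def)
  then have R: "h f g \<in> R \<longleftrightarrow> g \<in> R" for f g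
    using assms(6)[unfolded depends_on_def, rule_format, of "h f g" g] by simp
  have "(\<lambda>(f, g). h f g) -` (Q \<inter> R) = Q \<times> R" "(\<lambda>(f, g). h f g) -` Q = Q \<times> UNIV"
    "(\<lambda>(f, g). h f g) -` R = UNIV \<times> R"
    using Q R by auto
  then show ?thesis unfolding eq measure_map_pmf by (simp only: measure_pair_pmf_Times) simp
qed

lemma depends_on_subset: "depends_on Q B \<Longrightarrow> B \<subseteq> C \<Longrightarrow> depends_on Q C"
  unfolding depends_on_def by blast

lemma depends_on_INT: "(\<And>i. i \<in> J \<Longrightarrow> depends_on (Q i) B) \<Longrightarrow> depends_on (\<Inter>i\<in>J. Q i) B"
  unfolding depends_on_def by blast

lemma depends_on_Compl: "depends_on Q B \<Longrightarrow> depends_on (- Q) B"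
  unfolding depends_on_def by blast

text \<open>Induction on \<open>t\<close>: the intersection of the earlier events depends only on
  the union of their coin sets, which is disjoint from \<open>B t\<close>.\<close>

lemma prob_coins_INT:
  fixes t :: nat
  assumes "finite I" "\<And>i. i < t \<Longrightarrow> B i \<subseteq> I" "disjoint_family_on B {..<t}"
    and "\<And>i. i < t \<Longrightarrow> depends_on (Q i) (B i)"
  shows "measure_pmf.prob (coins I p) (\<Inter>i<t. Q i) = (\<Prod>i<t. measure_pmf.prob (coins I p) (Q i))"
  using assms(2-)
proof (induction t)
  case (Suc t)
  have "B t \<inter> (\<Union>i<t. B i) = {}"
    using Suc.prems(2) unfolding disjoint_family_on_def by (auto simp: lessThan_Suc)
  moreover have "depends_on (\<Inter>i<t. Q i) (\<Union>i<t. B i)"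
    using Suc.prems(3) by (intro depends_on_INT, rule depends_on_subset) auto
  moreover have "disjoint_family_on B {..<t}"
    using Suc.prems(2) by (auto simp: disjoint_family_on_def)
  ultimately have "measure_pmf.prob (coins I p) (Q t \<inter> (\<Inter>i<t. Q i)) =
      measure_pmf.prob (coins I p) (Q t) * measure_pmf.prob (coins I p) (\<Inter>i<t. Q i)"
    using Suc.prems by (intro prob_coins_indep[OF assms(1)]) (auto simp: UN_subset_iff)
  then show ?case
    using Suc.IH Suc.prems \<open>disjoint_family_on B {..<t}\<close> by (simp add: lessThan_Suc)
qed simp

section \<open>Distribution and concentration of counts\<close>

lemma prob_coins_card_eq:
  assumes "finite I" "B \<subseteq> I" "0 \<le> p" "p \<le> 1"
  shows "measure_pmf.prob (coins I p) {f. card {e\<in>B. f e} = k} =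
           real (card B choose k) * p ^ k * (1 - p) ^ (card B - k)"
proof -
  have fB: "finite B" using assms finite_subset by blast
  have "binomial_pmf (card B) p = map_pmf (\<lambda>f. card {e\<in>B. f e}) (coins B p)"
    using assms fB by (intro binomial_pmf_altdef') auto
  also have "\<dots> = map_pmf (\<lambda>f. card {e\<in>B. f e}) (coins I p)"
    unfolding Pi_pmf_subset[OF assms(1,2)] map_pmf_comp
    by (intro map_pmf_cong refl arg_cong[where f = card]) auto
  finally have "pmf (binomial_pmf (card B) p) k =
      measure_pmf.prob (coins I p) ((\<lambda>f. card {e\<in>B. f e}) -` {k})"
    by (simp add: pmf_map)
  then show ?thesis using assms by (simp add: vimage_def)
qed

text \<open>Chebyshev's inequality: pairwise independence bounds the variance by the mean. The
  events are left abstract to serve both lower bounds, for single edges in the dense case and for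
  vertices with a good block in the sparse one.\<close>

lemma prob_card_lower_tail:
  fixes M :: "'a pmf" and Z :: "'b \<Rightarrow> 'a set"
  assumes "finite R" "R \<noteq> {}" "q > 0" "\<And>v. v \<in> R \<Longrightarrow> measure_pmf.prob M (Z v) \<ge> q"
    and ind: "\<And>u v. u \<in> R \<Longrightarrow> v \<in> R \<Longrightarrow> u \<noteq> v \<Longrightarrow>
      measure_pmf.prob M (Z u \<inter> Z v) = measure_pmf.prob M (Z u) * measure_pmf.prob M (Z v)"
  shows "measure_pmf.prob M {f. real (card {v\<in>R. f \<in> Z v}) < 3 / 4 * (q * real (card R))} \<le>
           16 / (q * real (card R))"
proof -
  let ?P = "measure_pmf.prob M" and ?E = "measure_pmf.expectation M"
  define X where "X f = (\<Sum>v\<in>R. indicator (Z v) f :: real)" for f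
  define \<mu> where "\<mu> = (\<Sum>v\<in>R. ?P (Z v))"
  have cX: "real (card {v\<in>R. f \<in> Z v}) = X f" for f
  proof -
    have "X f = (\<Sum>v\<in>{v\<in>R. f \<in> Z v}. 1)"
      unfolding X_def using assms(1) by (intro sum.mono_neutral_cong_right) auto
    then show ?thesis by simp
  qed
  have ind_int: "integrable M (indicator A :: 'a \<Rightarrow> real)" for A
    by (rule measure_pmf.integrable_const_bound[where B = 1]) auto
  have EX: "?E X = \<mu>"
    unfolding X_def \<mu>_def by (subst Bochner_Integration.integral_sum) (simp_all add: ind_int)
  have int: "integrable M X"
    unfolding X_def by (intro Bochner_Integration.integrable_sum ind_int)
  have X2: "X f ^ 2 = (\<Sum>u\<in>R. \<Sum>v\<in>R. indicator (Z u \<inter> Z v) f)" for f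
    unfolding X_def power2_eq_square sum_product by (simp add: indicator_inter_arith)
  have int2: "integrable M (\<lambda>f. X f ^ 2)"
    unfolding X2 by (intro Bochner_Integration.integrable_sum ind_int)
  have EX2: "?E (\<lambda>f. X f ^ 2) = (\<Sum>u\<in>R. \<Sum>v\<in>R. ?P (Z u \<inter> Z v))"
    unfolding X2
    by (simp add: Bochner_Integration.integral_sum Bochner_Integration.integrable_sum ind_int
        del: integrable_indicator_iff)
  \<comment> \<open>Only the diagonal term \<open>v = u\<close> deviates from the product, and it
    contributes at most \<open>?P (Z u)\<close>.\<close>
  have "(\<Sum>v\<in>R. ?P (Z u \<inter> Z v)) \<le> ?P (Z u) + (\<Sum>v\<in>R. ?P (Z u) * ?P (Z v))" if u: "u \<in> R" for u
  proof -
    have "(\<Sum>v\<in>R. ?P (Z u \<inter> Z v)) \<le> (\<Sum>v\<in>R. (if v = u then ?P (Z u) else 0) + ?P (Z u) * ?P (Z v))"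
      using ind u by (intro sum_mono) auto
    then show ?thesis using u assms(1) by (simp add: sum.distrib)
  qed
  then have "?E (\<lambda>f. X f ^ 2) \<le> (\<Sum>u\<in>R. ?P (Z u) + (\<Sum>v\<in>R. ?P (Z u) * ?P (Z v)))"
    unfolding EX2 by (intro sum_mono)
  also have "\<dots> = \<mu> + \<mu>\<^sup>2" by (simp add: sum.distrib \<mu>_def power2_eq_square sum_product)
  finally have var: "measure_pmf.variance M X \<le> \<mu>"
    using measure_pmf.variance_eq[OF int int2] EX by simp
  have pos: "0 < q * real (card R)" using assms(1-3) by (simp add: card_gt_0_iff)
  have \<mu>: "q * real (card R) \<le> \<mu>"
    using sum_bounded_below[of R q "\<lambda>v. ?P (Z v)"] assms(4) by (simp add: \<mu>_def mult.commute)
  \<comment> \<open>A count below \<open>3 / 4 * (q * card R)\<close> is below three quarters of the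
    mean, so it deviates by at least a quarter of the mean.\<close>
  have "?P {f. real (card {v\<in>R. f \<in> Z v}) < 3 / 4 * (q * real (card R))} \<le>
      ?P {f \<in> space M. \<bar>X f - ?E X\<bar> \<ge> \<mu> / 4}"
    unfolding cX using \<mu> pos by (intro measure_pmf.finite_measure_mono) (auto simp: EX)
  also have "\<dots> \<le> measure_pmf.variance M X / (\<mu> / 4)\<^sup>2"
    using \<mu> pos int2 by (intro measure_pmf.Chebyshev_inequality) auto
  also have "\<dots> \<le> \<mu> / (\<mu> / 4)\<^sup>2" using var by (intro divide_right_mono) auto
  also have "\<dots> = 16 / \<mu>" using \<mu> pos by (simp add: power2_eq_square)
  also have "\<dots> \<le> 16 / (q * real (card R))" using \<mu> pos by (intro divide_left_mono) auto
  finally show ?thesis .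
qed

lemma measure_gnp:
  "measure_pmf.prob (gnp N p) Q =
     measure_pmf.prob (coins (all_edges N) p) {f. {e \<in> all_edges N. f e} \<in> Q}"
  by (simp add: gnp_def measure_map_pmf vimage_def)

subsection \<open>Lower bound for dense graphs\<close>

text \<open>The remainder is less than \<open>n\<close>, while at least three full blocks fit; so
  the remainder is at most a quarter of \<open>N\<close>.\<close>

lemma div_mult_ge_three_quarters:
  assumes "0 < n" "3 * n \<le> (N::nat)"
  shows "3 / 4 * real N \<le> real (N div n) * real n"
proof -
  have lt: "N < n + N div n * n" using dividend_less_div_times[OF assms(1)] by simp
  have "3 \<le> N div n" using div_le_mono[OF assms(2), of n] assms(1) by simp
  then have "3 * n \<le> N div n * n" by (rule mult_le_mono1)
  then have "3 * N \<le> 4 * (N div n * n)" using lt by linarith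
  then have "real (3 * N) \<le> real (4 * (N div n * n))" by (rule of_nat_mono)
  then show ?thesis by simp
qed

text \<open>The factor 3 exceeds Euler's number.\<close>

lemma one_le_ln_ratio:
  assumes "0 < n" "3 * n \<le> (N::nat)"
  shows "1 \<le> ln (real N / real n)"
proof -
  have "3 \<le> real N / real n"
    using of_nat_mono[OF assms(2), where 'a = real] assms(1) by (simp add: field_simps)
  then have "exp 1 \<le> real N / real n" using exp_le by linarith
  then show ?thesis using assms by (simp add: ln_ge_iff)
qed

text \<open>The blocks contain at least \<open>27 / 80 * n * N\<close> pairs: three quarters of
  \<open>N\<close> from full blocks, times \<open>9 / 20 * n\<close> from \<open>n choose 2\<close>,
  where \<open>n >= 10\<close> is used. Losing another quarter to concentration leaves
  \<open>81 / 320\<close>, just above \<open>1 / 4\<close>. The lower bound on \<open>p\<close>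
  gives \<open>p * n >= 1 / 6\<close>, so the mean is at least linear in \<open>n\<close>.\<close>

lemma ex_path_lower_cliques:
  assumes n: "10 \<le> n" and N: "3 * n \<le> N" and p: "0 < p" "p \<le> 1"
    and pL: "ln (real N / real n) / (6 * real n) \<le> p"
  shows "measure_pmf.prob (gnp N p) {E. E \<subseteq> all_edges N \<and> real (ex_path E (n + 1)) < 1 / 4 * p * real n * real N}
           \<le> 100 / real n"
proof -
  define t where "t = N div n"
  define Bl where "Bl i = {e. e \<subseteq> {i * n..<i * n + n} \<and> card e = 2}" for i
  define M where "M = (\<Union>i<t. Bl i)"
  have n0: "0 < n" using n by simp
  have Bl: "u div n = i \<and> v div n = i" if "{u, v} \<in> Bl i" for u v i
    using that n0 by (auto simp: Bl_def intro!: div_nat_eqI simp: mult.commute)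
  have "t * n \<le> N" unfolding t_def by simp
  then have "i * n + n \<le> N" if "i < t" for i
    using mult_le_mono1[of "Suc i" t n] that by simp
  then have sub: "M \<subseteq> all_edges N" by (fastforce simp: M_def Bl_def all_edges_alt)
  have fBl: "finite (Bl i)" for i
    unfolding Bl_def by (rule finite_subset[of _ "Pow {i * n..<i * n + n}"]) auto
  have "card M = (\<Sum>i<t. card (Bl i))"
    unfolding M_def
  proof (rule card_UN_disjoint)
    show "\<forall>i\<in>{..<t}. \<forall>j\<in>{..<t}. i \<noteq> j \<longrightarrow> Bl i \<inter> Bl j = {}"
    proof (intro ballI impI equals0I)
      fix i j e assume "i \<noteq> j" and e: "e \<in> Bl i \<inter> Bl j"
      then obtain u v where "e = {u, v}" by (auto simp: Bl_def card_2_iff)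
      then show False using Bl[of u v i] Bl[of u v j] e \<open>i \<noteq> j\<close> by auto
    qed
  qed (auto simp: fBl)
  also have "\<dots> = t * (n choose 2)" by (simp add: Bl_def n_subsets)
  finally have cM: "card M = t * (n choose 2)" .
  have "9 * (n * n) \<le> 10 * (n * (n - 1))"
  proof -
    have "9 * n \<le> 10 * (n - 1)" using n by simp
    then have "n * (9 * n) \<le> n * (10 * (n - 1))" by (rule mult_le_mono2)
    then show ?thesis by (simp add: ac_simps)
  qed
  moreover have "n * (n - 1) = 2 * (n choose 2)"
    unfolding choose_two by (cases n) simp_all
  ultimately have "9 * (n * n) \<le> 20 * (n choose 2)" by linarith
  then have "real (9 * (n * n)) \<le> real (20 * (n choose 2))" by (rule of_nat_mono)
  then have ch: "9 / 20 * (real n * real n) \<le> real (n choose 2)" by simp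
  have "27 / 80 * real n * real N = 3 / 4 * real N * (9 / 20 * real n)" by simp
  also have "\<dots> \<le> real t * real n * (9 / 20 * real n)"
    unfolding t_def by (intro mult_right_mono div_mult_ge_three_quarters n0 N) auto
  also have "\<dots> = real t * (9 / 20 * (real n * real n))" by simp
  also have "\<dots> \<le> real (card M)" unfolding cM of_nat_mult using ch by (intro mult_left_mono) auto
  finally have M: "27 / 80 * real n * real N \<le> real (card M)" .
  have N0: "0 < real N" using n N by simp
  have "0 < 27 / 80 * real n * real N" using n0 N0 by simp
  then have M0: "0 < real (card M)" using M by linarith
  have "1 / (6 * real n) \<le> ln (real N / real n) / (6 * real n)"
    using one_le_ln_ratio[OF n0 N] by (intro divide_right_mono) auto
  then have "1 / (6 * real n) \<le> p" using pL by linarith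
  then have pn: "1 / 6 \<le> p * real n" using n0 by (simp add: field_simps)
  have pM: "p * (27 / 80 * real n * real N) \<le> p * real (card M)"
    using M p by (intro mult_left_mono) auto
  have "27 / 160 * real n = 27 / 80 * (1 / 6 * (3 * real n))" by simp
  also have "\<dots> \<le> 27 / 80 * (p * real n * real N)"
    using pn N by (intro mult_left_mono mult_mono) auto
  also have "\<dots> = p * (27 / 80 * real n * real N)" by simp
  finally have nM: "27 / 160 * real n \<le> p * real (card M)" using pM by linarith
  let ?C = "coins (all_edges N) p"
  have "measure_pmf.prob (gnp N p) {E. E \<subseteq> all_edges N \<and> real (ex_path E (n + 1)) < 1 / 4 * p * real n * real N}
      \<le> measure_pmf.prob ?C {f. real (card {e\<in>M. f \<in> {f. f e}}) < 3 / 4 * (p * real (card M))}"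
    unfolding measure_gnp
  proof (rule measure_pmf.finite_measure_mono, safe)
    fix f assume lt: "real (ex_path {e \<in> all_edges N. f e} (n + 1)) < 1 / 4 * p * real n * real N"
    have "\<not> has_path {e\<in>M. f e} (n + 1)"
      using sub Bl n0 by (intro no_path_in_blocks[where N = N]) (auto simp: M_def)
    then have "card {e\<in>M. f e} \<le> ex_path {e \<in> all_edges N. f e} (n + 1)"
      using sub by (intro card_le_ex_path) auto
    then have "real (card {e\<in>M. f e}) < 1 / 4 * p * real n * real N" using lt by simp
    also have "\<dots> \<le> 3 / 4 * (p * (27 / 80 * real n * real N))" using p by simp
    also have "\<dots> \<le> 3 / 4 * (p * real (card M))" by (intro mult_left_mono pM) simp
    finally show "real (card {e\<in>M. f \<in> {f. f e}}) < 3 / 4 * (p * real (card M))" by simp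
  qed simp
  also have "\<dots> \<le> 16 / (p * real (card M))"
  proof (rule prob_card_lower_tail)
    show "finite M" by (rule finite_subset[OF sub finite_all_edges])
    show "M \<noteq> {}" using M0 by auto
    show "p \<le> measure_pmf.prob ?C {f. f v}" if "v \<in> M" for v
      using prob_coins_all[of "all_edges N" "{v}" p] that sub p by auto
    show "measure_pmf.prob ?C ({f. f u} \<inter> {f. f v}) =
        measure_pmf.prob ?C {f. f u} * measure_pmf.prob ?C {f. f v}"
      if "u \<in> M" "v \<in> M" "u \<noteq> v" for u v
      using that sub by (intro prob_coins_indep[of _ "{u}" "{v}"]) (auto simp: depends_on_def)
  qed (use p in auto)
  also have "\<dots> \<le> 16 / (27 / 160 * real n)" using nM n0 by (intro divide_left_mono) auto
  also have "\<dots> \<le> 100 / real n" using n0 by (simp add: field_simps)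
  finally show ?thesis .
qed

subsection \<open>Lower bound for sparse graphs\<close>

text \<open>The potential edges from \<open>v\<close> to the block \<open>i\<close> of
  \<open>a\<close> consecutive vertices. It is applied with \<open>i < t\<close> and
  \<open>v >= t * a\<close>, so that \<open>v\<close> lies outside all \<open>t\<close>
  blocks.\<close>

definition star :: "nat \<Rightarrow> nat \<Rightarrow> nat \<Rightarrow> nat set set" where
  "star a v i = (\<lambda>u. {v, u}) ` {i * a..<i * a + a}"

lemma
  assumes "i < t" "t * a \<le> v" "v < N"
  shows star_subset: "star a v i \<subseteq> all_edges N"
    and card_star: "card (star a v i) = a"
    and mem_star: "{x, y} \<in> star a v i \<Longrightarrow>
      x = v \<and> y < t * a \<and> y div a = i \<or> y = v \<and> x < t * a \<and> x div a = i"
proof -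
  have "Suc i * a \<le> t * a" using assms(1) by (intro mult_le_mono1) simp
  then have le: "i * a + a \<le> t * a" by simp
  then show "star a v i \<subseteq> all_edges N" using assms by (auto simp: star_def)
  have "inj_on (\<lambda>u. {v, u}) {i * a..<i * a + a}"
    using le assms by (auto simp: inj_on_def doubleton_eq_iff)
  then show "card (star a v i) = a" by (simp add: star_def card_image)
  show "x = v \<and> y < t * a \<and> y div a = i \<or> y = v \<and> x < t * a \<and> x div a = i"
    if xy: "{x, y} \<in> star a v i"
  proof -
    obtain u where u: "{x, y} = {v, u}" "i * a \<le> u" "u < i * a + a" using xy by (auto simp: star_def)
    have "u div a = i" using u by (intro div_nat_eqI) (auto simp: mult.commute)
    then show ?thesis using u le by (auto simp: doubleton_eq_iff)
  qed
qed

text \<open>The endpoint at or above \<open>t * a\<close> determines the centre of the star, and the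
  other endpoint determines the block.\<close>

lemma star_disjoint:
  assumes "i < t" "j < t" "t * a \<le> v" "t * a \<le> w" "v < N" "w < N" "v \<noteq> w \<or> i \<noteq> j"
  shows "star a v i \<inter> star a w j = {}"
proof (rule equals0I)
  fix e assume e: "e \<in> star a v i \<inter> star a w j"
  then obtain x where "e = {v, x}" by (auto simp: star_def)
  then show False
    using mem_star[of i t a v N v x] mem_star[of j t a w N v x] e assms by auto
qed

text \<open>Each good vertex \<open>v\<close> chooses one block \<open>c0 v\<close> and keeps all
  its edges to it. The colour \<open>c\<close> is the block number, inherited by \<open>v\<close>
  from its choice, so components do not mix blocks; disjointness of the stars gives at least
  \<open>d\<close> edges for each good vertex.\<close>

lemma small_vertex_covers_le_ex_path:
  assumes "0 < a" "2 * a + 1 \<le> n" "t * a \<le> N" "E \<subseteq> all_edges N"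
  shows "d * card {v \<in> {t * a..<N}. \<exists>i<t. d \<le> card {e \<in> star a v i. e \<in> E}} \<le> ex_path E (n + 1)"
proof -
  define G where "G = {v \<in> {t * a..<N}. \<exists>i<t. d \<le> card {e \<in> star a v i. e \<in> E}}"
  define c0 where "c0 v = (SOME i. i < t \<and> d \<le> card {e \<in> star a v i. e \<in> E})" for v
  define c where "c u = (if u < t * a then u div a else c0 u)" for u
  define F where "F = (\<Union>v\<in>G. {e \<in> star a v (c0 v). e \<in> E})"
  have c0: "c0 v < t \<and> d \<le> card {e \<in> star a v (c0 v). e \<in> E}" if "v \<in> G" for v
    using that someI_ex[of "\<lambda>i. i < t \<and> d \<le> card {e \<in> star a v i. e \<in> E}"]
    unfolding c0_def G_def by blast
  have G: "t * a \<le> v" "v < N" if "v \<in> G" for v using that by (auto simp: G_def)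
  have F: "(u < t * a \<or> v < t * a) \<and> c u = c v" if uv: "{u, v} \<in> F" for u v
  proof -
    obtain w where w: "w \<in> G" "{u, v} \<in> star a w (c0 w)" using uv by (auto simp: F_def)
    show ?thesis
      using mem_star[of "c0 w" t a w N u v] c0[OF w(1)] G[OF w(1)] w(2) by (auto simp: c_def)
  qed
  have "d * card G = (\<Sum>v\<in>G. d)" by simp
  also have "\<dots> \<le> (\<Sum>v\<in>G. card {e \<in> star a v (c0 v). e \<in> E})"
    using c0 by (intro sum_mono) auto
  also have "\<dots> = card F"
    unfolding F_def
  proof (rule card_UN_disjoint[symmetric])
    show "finite G" by (simp add: G_def)
    show "\<forall>v\<in>G. \<forall>w\<in>G. v \<noteq> w \<longrightarrow>
        {e \<in> star a v (c0 v). e \<in> E} \<inter> {e \<in> star a w (c0 w). e \<in> E} = {}"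
    proof (intro ballI impI)
      fix v w assume "v \<in> G" "w \<in> G" "v \<noteq> w"
      then have "star a v (c0 v) \<inter> star a w (c0 w) = {}"
        using c0 G by (intro star_disjoint[where t = t and N = N]) auto
      then show "{e \<in> star a v (c0 v). e \<in> E} \<inter> {e \<in> star a w (c0 w). e \<in> E} = {}" by blast
    qed
  qed (simp add: star_def)
  also have "\<dots> \<le> ex_path E (n + 1)"
  proof (rule card_le_ex_path)
    show "finite E" by (rule finite_subset[OF assms(4) finite_all_edges])
    show "\<not> has_path F (n + 1)"
      using F by (intro no_path_if_small_vertex_covers[OF assms(1,2), where m = "t * a" and c = c])
        (auto simp: c_def)
  qed (auto simp: F_def)
  finally show ?thesis by (simp add: G_def)
qed

text \<open>Stars are disjoint, which is used twice. For a fixed vertex the \<open>t\<close> blocks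
  fail independently, so some block works with probability at least \<open>1 - (1 - r) ^ t\<close>;
  for different vertices success is independent, so the number of good vertices
  concentrates.\<close>

lemma ex_path_lower_small_vertex_covers:
  assumes a: "0 < a" "2 * a + 1 \<le> n" and ta: "t * a < N" and p: "0 \<le> p" "p \<le> 1"
    and r: "\<And>B. B \<subseteq> all_edges N \<Longrightarrow> card B = a \<Longrightarrow>
      r \<le> measure_pmf.prob (coins (all_edges N) p) {f. d \<le> card {e\<in>B. f e}}"
    and q: "0 < q" "q \<le> 1 - (1 - r) ^ t"
  shows "measure_pmf.prob (gnp N p)
           {E. E \<subseteq> all_edges N \<and> real (ex_path E (n + 1)) < real d * (3 / 4 * (q * real (N - t * a)))}
         \<le> 16 / (q * real (N - t * a))"
proof -
  let ?C = "coins (all_edges N) p"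
  define W where "W v i = {f :: nat set \<Rightarrow> bool. d \<le> card {e \<in> star a v i. f e}}" for v i
  define Z where "Z v = (\<Union>i<t. W v i)" for v
  define R where "R = {t * a..<N}"
  have depW: "depends_on (W v i) (star a v i)" for v i
    unfolding depends_on_def W_def by (auto cong: conj_cong Collect_cong)
  have "measure_pmf.prob (gnp N p)
      {E. E \<subseteq> all_edges N \<and> real (ex_path E (n + 1)) < real d * (3 / 4 * (q * real (N - t * a)))}
      \<le> measure_pmf.prob ?C {f. real (card {v\<in>R. f \<in> Z v}) < 3 / 4 * (q * real (card R))}"
    unfolding measure_gnp
  proof (rule measure_pmf.finite_measure_mono, safe)
    fix f assume lt: "real (ex_path {e \<in> all_edges N. f e} (n + 1)) < real d * (3 / 4 * (q * real (N - t * a)))"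
    have "{e \<in> star a v i. e \<in> {e \<in> all_edges N. f e}} = {e \<in> star a v i. f e}"
      if "v \<in> R" "i < t" for v i
      using star_subset[of i t a v N] that by (auto simp: R_def)
    then have "{v \<in> R. \<exists>i<t. d \<le> card {e \<in> star a v i. e \<in> {e \<in> all_edges N. f e}}} = {v\<in>R. f \<in> Z v}"
      by (auto simp: Z_def W_def)
    then have "d * card {v\<in>R. f \<in> Z v} \<le> ex_path {e \<in> all_edges N. f e} (n + 1)"
      using small_vertex_covers_le_ex_path[OF a, of t N "{e \<in> all_edges N. f e}" d] ta by (simp add: R_def)
    then have "real d * real (card {v\<in>R. f \<in> Z v}) \<le> real (ex_path {e \<in> all_edges N. f e} (n + 1))"
      by (simp only: of_nat_mult[symmetric] of_nat_le_iff)
    then have "real d * real (card {v\<in>R. f \<in> Z v}) < real d * (3 / 4 * (q * real (N - t * a)))"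
      using lt by (rule order.strict_trans1)
    then show "real (card {v\<in>R. f \<in> Z v}) < 3 / 4 * (q * real (card R))"
      by (simp only: R_def card_atLeastLessThan mult_less_cancel_left)
  qed simp
  also have "\<dots> \<le> 16 / (q * real (card R))"
  proof (rule prob_card_lower_tail)
    show "finite R" "R \<noteq> {}" using ta by (auto simp: R_def)
    show "q \<le> measure_pmf.prob ?C (Z v)" if "v \<in> R" for v
    proof -
      have v: "t * a \<le> v" "v < N" using that by (auto simp: R_def)
      have "measure_pmf.prob ?C (\<Inter>i<t. - W v i) = (\<Prod>i<t. measure_pmf.prob ?C (- W v i))"
        using v star_subset star_disjoint
        by (intro prob_coins_INT[where B = "star a v"])
          (auto simp: disjoint_family_on_def depW depends_on_Compl)
      also have "\<dots> \<le> (\<Prod>i<t. 1 - r)"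
      proof (rule prod_mono)
        fix i assume "i \<in> {..<t}"
        then have "r \<le> measure_pmf.prob ?C (W v i)"
          using v star_subset card_star unfolding W_def by (intro r) auto
        then show "0 \<le> measure_pmf.prob ?C (- W v i) \<and> measure_pmf.prob ?C (- W v i) \<le> 1 - r"
          using measure_pmf.prob_compl[of "W v i" ?C] by (simp add: Compl_eq_Diff_UNIV)
      qed
      finally have "measure_pmf.prob ?C (- Z v) \<le> (1 - r) ^ t" by (simp add: Z_def)
      then show ?thesis
        using q(2) measure_pmf.prob_compl[of "Z v" ?C] by (simp add: Compl_eq_Diff_UNIV)
    qed
    show "measure_pmf.prob ?C (Z u \<inter> Z v) = measure_pmf.prob ?C (Z u) * measure_pmf.prob ?C (Z v)"
      if uv: "u \<in> R" "v \<in> R" "u \<noteq> v" for u v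
    proof (rule prob_coins_indep)
      \<comment> \<open>\<open>Z v\<close> is written as the complement of an intersection, the form
        covered by the closure rules.\<close>
      have "depends_on (- (\<Inter>i<t. - W v i)) (\<Union>i<t. star a v i)" for v
        by (intro depends_on_Compl depends_on_INT, rule depends_on_subset[OF depW]) auto
      then show "depends_on (Z u) (\<Union>i<t. star a u i)" "depends_on (Z v) (\<Union>i<t. star a v i)"
        by (simp_all add: Z_def)
      have "star a u i \<inter> star a v j = {}" if "i < t" "j < t" for i j
        using that uv by (intro star_disjoint[of i t j a u v N]) (auto simp: R_def)
      then show "(\<Union>i<t. star a u i) \<inter> (\<Union>i<t. star a v i) = {}" by blast
    qed (use uv star_subset in \<open>auto simp: R_def UN_subset_iff\<close>)
  qed (rule q(1))
  finally show ?thesis by (simp add: R_def)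
qed

text \<open>There are two regimes for \<open>y\<close>. If \<open>y <= 6\<close>, one neighbour in
  some block suffices (\<open>d = 1\<close>); otherwise about \<open>y / 12\<close> neighbours are
  required. In both, each vertex outside the blocks succeeds with at least a constant
  probability.\<close>

lemma ex_path_lower_sparse:
  fixes p :: real and n N :: nat
  defines "L \<equiv> ln (real N / real n)"
  defines "\<omega> \<equiv> L / (real n * p)"
  assumes n: "10 \<le> n" and N: "3 * n \<le> N" "real N \<le> real n * exp (2 * real n)"
    and p: "0 < p" "p \<le> 1" "1 / real N \<le> p" "p \<le> L / (6 * real n)"
  shows "measure_pmf.prob (gnp N p)
           {E. E \<subseteq> all_edges N \<and> real (ex_path E (n + 1)) < 1 / 75 * (\<omega> / ln \<omega>) * p * real n * real N}
         \<le> 100 / real n"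
proof -
  \<comment> \<open>The largest block size with \<open>2 * a + 1 <= n\<close>; for
    \<open>n >= 10\<close> it is at least \<open>2 / 5 * n\<close>.\<close>
  define a where "a = (n - 1) div 2"
  define t where "t = N div n"
  define W where "W = ln \<omega>"
  define y where "y = L / W"
  have n0: "0 < n" and N0: "0 < real N" using n N by auto
  have a: "0 < a" "2 * a + 1 \<le> n" using n by (auto simp: a_def)
  have "2 * n \<le> 5 * a" using n unfolding a_def by presburger
  then have "real (2 * n) \<le> real (5 * a)" by (rule of_nat_mono)
  then have an: "2 / 5 * real n \<le> real a" by simp
  have "t * (2 * a) \<le> t * n" using a by (intro mult_le_mono2) simp
  moreover have "t * n \<le> N" by (simp add: t_def)
  ultimately have "t * (2 * a) \<le> N" by (rule le_trans)
  then have ta2: "2 * (t * a) \<le> N" by (simp only: mult.left_commute)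
  then have taN: "t * a < N" using N0 by simp
  have half: "1 / 2 * real N \<le> real (N - t * a)"
  proof -
    have "N \<le> 2 * (N - t * a)" using ta2 by linarith
    then have "real N \<le> real (2 * (N - t * a))" by (rule of_nat_mono)
    then show ?thesis by simp
  qed
  have tn: "3 / 4 * real N \<le> real t * real n"
    unfolding t_def by (rule div_mult_ge_three_quarters[OF n0 N(1)])
  have L: "1 \<le> L" unfolding L_def by (rule one_le_ln_ratio[OF n0 N(1)])
  have expL: "exp L = real N / real n" using N0 n0 by (simp add: L_def)
  \<comment> \<open>The upper bound on \<open>N\<close> enters here as \<open>L <= 2 * n\<close>,
    which later yields \<open>p <= 1 / 3\<close> and \<open>d <= a\<close>.\<close>
  have "exp L \<le> exp (2 * real n)" using N(2) n0 by (simp add: expL field_simps)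
  then have L2: "L \<le> 2 * real n" by simp
  have np: "0 < real n * p" "6 * (real n * p) \<le> L" using p n0 by (auto simp: field_simps)
  have \<omega>: "6 \<le> \<omega>" using np by (simp add: \<omega>_def le_divide_eq)
  \<comment> \<open>This shows \<open>ln 6 >= 3 / 2\<close>, by comparing squares.\<close>
  have "exp (3 / 2 :: real) ^ 2 = exp 1 ^ 3" by (simp flip: exp_of_nat_mult)
  also have "\<dots> \<le> 3 ^ 3" using exp_le by (intro power_mono) auto
  also have "\<dots> \<le> (6::real) ^ 2" by simp
  finally have "exp (3 / 2 :: real) \<le> 6" by (rule power2_le_imp_le) simp
  then have W: "3 / 2 \<le> W" unfolding W_def using \<omega> by (subst ln_ge_iff) auto
  have Ly: "L = y * W" using W by (simp add: y_def)
  have y0: "0 < y" using L W by (simp add: y_def)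
  \<comment> \<open>By definition \<open>\<omega> * p * n = L\<close>, so the claimed bound is
    \<open>y * N / 75\<close>.\<close>
  have target: "1 / 75 * (\<omega> / ln \<omega>) * p * real n * real N = 1 / 75 * (y * real N)"
    using np by (simp add: \<omega>_def y_def W_def)
  let ?C = "coins (all_edges N) p"
  \<comment> \<open>The common end of both regimes: \<open>r\<close> bounds the success of one
    block, \<open>q\<close> that of one vertex. In the last condition \<open>3 / 4\<close> is the
    loss from concentration and \<open>1 / 2\<close> the share of vertices outside the
    blocks.\<close>
  have concl: ?thesis
    if r: "\<And>B. B \<subseteq> all_edges N \<Longrightarrow> card B = a \<Longrightarrow> r \<le> measure_pmf.prob ?C {f. d \<le> card {e\<in>B. f e}}"
      and q: "1 / 4 \<le> q" "q \<le> 1 - (1 - r) ^ t"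
      and d: "1 / 75 * (y * real N) \<le> real d * (3 / 4 * (q * (1 / 2 * real N)))"
    for r q :: real and d :: nat
  proof -
    have qN: "q * (1 / 2 * real N) \<le> q * real (N - t * a)"
      using half q by (intro mult_left_mono) auto
    have "3 / 8 * real n = 1 / 4 * (1 / 2 * (3 * real n))" by simp
    also have "\<dots> \<le> q * (1 / 2 * real N)"
      using q N by (intro mult_mono) auto
    finally have nq: "3 / 8 * real n \<le> q * real (N - t * a)" using qN by linarith
    have "measure_pmf.prob (gnp N p)
        {E. E \<subseteq> all_edges N \<and> real (ex_path E (n + 1)) < 1 / 75 * (\<omega> / ln \<omega>) * p * real n * real N}
      \<le> measure_pmf.prob (gnp N p)
        {E. E \<subseteq> all_edges N \<and> real (ex_path E (n + 1)) < real d * (3 / 4 * (q * real (N - t * a)))}"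
    proof (rule measure_pmf.finite_measure_mono)
      have "real d * (3 / 4 * (q * (1 / 2 * real N))) \<le> real d * (3 / 4 * (q * real (N - t * a)))"
        by (intro mult_left_mono qN) auto
      then show "{E. E \<subseteq> all_edges N \<and>
            real (ex_path E (n + 1)) < 1 / 75 * (\<omega> / ln \<omega>) * p * real n * real N} \<subseteq>
          {E. E \<subseteq> all_edges N \<and> real (ex_path E (n + 1)) < real d * (3 / 4 * (q * real (N - t * a)))}"
        unfolding target using d by (intro Collect_mono) linarith
    qed simp
    also have "\<dots> \<le> 16 / (q * real (N - t * a))"
      using a taN p r q by (intro ex_path_lower_small_vertex_covers[where r = r]) auto
    also have "\<dots> \<le> 16 / (3 / 8 * real n)"
    proof (rule divide_left_mono[OF nq])
      have *: "0 < 3 / 8 * real n" using n0 by simp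
      then have "0 < q * real (N - t * a)" using nq by linarith
      then show "0 < q * real (N - t * a) * (3 / 8 * real n)" using * by (rule mult_pos_pos)
    qed simp
    also have "\<dots> \<le> 100 / real n" using n0 by (simp add: field_simps)
    finally show ?thesis .
  qed
  show ?thesis
  proof (cases "y \<le> 6")
    case True
    show ?thesis
    proof (rule concl[where r = "1 - (1 - p) ^ a" and q = "1 / 4" and d = 1])
      fix B assume B: "B \<subseteq> all_edges N" "card B = a"
      have "{f. 1 \<le> card {e\<in>B. f e}} = UNIV - {f. card {e\<in>B. f e} = 0}" by auto
      then have "measure_pmf.prob ?C {f. 1 \<le> card {e\<in>B. f e}} =
          1 - measure_pmf.prob ?C {f. card {e\<in>B. f e} = 0}"
        using measure_pmf.prob_compl[of "{f. card {e\<in>B. f e} = 0}" ?C] by simp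
      also have "\<dots> = 1 - (1 - p) ^ a"
        using B p by (subst prob_coins_card_eq) auto
      finally show "1 - (1 - p) ^ a \<le> measure_pmf.prob ?C {f. 1 \<le> card {e\<in>B. f e}}" by simp
    next
      \<comment> \<open>All blocks together hold at least \<open>3 / 10 * N\<close> vertices. With
        \<open>p * N >= 1\<close> a vertex misses them all with probability at most
        \<open>exp (- (3 / 10))\<close>.\<close>
      have "3 / 10 * real N = 2 / 5 * (3 / 4 * real N)" by simp
      also have "\<dots> \<le> 2 / 5 * (real t * real n)" using tn by (intro mult_left_mono) auto
      also have "\<dots> = real t * (2 / 5 * real n)" by simp
      also have "\<dots> \<le> real t * real a" using an by (intro mult_left_mono) auto
      finally have "p * (3 / 10 * real N) \<le> p * (real t * real a)"
        using p by (intro mult_left_mono) auto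
      moreover have "1 \<le> p * real N" using p(3) N0 by (simp add: divide_le_eq)
      ultimately have pta: "3 / 10 \<le> real (a * t) * p" by (simp add: algebra_simps)
      have "((1 - p) ^ a) ^ t = (1 - p) ^ (a * t)" by (simp add: power_mult)
      also have "\<dots> \<le> exp (- p) ^ (a * t)"
        using p exp_ge_add_one_self[of "- p"] by (intro power_mono) auto
      also have "\<dots> = exp (- (real (a * t) * p))" by (simp flip: exp_of_nat_mult)
      also have "\<dots> \<le> exp (- (3 / 10))" using pta by simp
      also have "\<dots> \<le> 3 / 4"
      proof -
        have "4 / 3 \<le> 1 + 3 / 10 + (3 / 10)\<^sup>2 / (2::real)" by (simp add: power2_eq_square)
        also have "\<dots> \<le> exp (3 / 10)" by (rule exp_lower_Taylor_quadratic) simp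
        finally show ?thesis by (simp add: exp_minus field_simps)
      qed
      finally show "1 / 4 \<le> 1 - (1 - (1 - (1 - p) ^ a)) ^ t" by simp
    next
      have "y * real N \<le> 6 * real N" using True by (intro mult_right_mono) auto
      then show "1 / 75 * (y * real N) \<le> real 1 * (3 / 4 * (1 / 4 * (1 / 2 * real N)))" by simp
    qed simp
  next
    case False
    define d where "d = nat \<lceil>y / 12\<rceil>"
    have d: "0 < d" "y / 12 \<le> real d" "real d \<le> y / 12 + 1"
      using y0 by (auto simp: d_def)
    \<comment> \<open>From \<open>y > 6\<close> the rounding error 1 is below \<open>y / 6\<close>,
      and \<open>1 / 12 + 1 / 6 = 1 / 4\<close>.\<close>
    have dy: "real d \<le> y / 4" using d False by simp
    have dW: "real d * W \<le> L / 4"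
      using mult_right_mono[OF dy, of W] W by (simp add: Ly)
    have "3 / 2 * real d \<le> W * real d" using W by (intro mult_right_mono) auto
    then have dL: "real d \<le> L / 6" using dW by (simp add: mult.commute)
    then have "real d \<le> real a" using L2 an by simp
    then have da: "d \<le> a" by simp
    show ?thesis
    proof (rule concl[where r = "exp (- (L / 2))" and q = "1 / 2" and d = d])
      fix B assume B: "B \<subseteq> all_edges N" "card B = a"
      \<comment> \<open>The failures cost at most a factor \<open>exp (- (L / 6))\<close>:
        \<open>p <= 1 / 3\<close> gives \<open>1 - p >= exp (- (2 * p))\<close>, and
        \<open>2 * a * p <= n * p <= L / 6\<close>.\<close>
      have "L / (6 * real n) \<le> 2 * real n / (6 * real n)" by (intro divide_right_mono L2) simp
      also have "\<dots> = 1 / 3" using n0 by simp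
      finally have "p \<le> 1 / 3" using p(4) by linarith
      then have "p * (1 - 2 * p) \<ge> 0" using p by (intro mult_nonneg_nonneg) auto
      then have "1 \<le> (1 + 2 * p) * (1 - p)" by (simp add: algebra_simps)
      also have "\<dots> \<le> exp (2 * p) * (1 - p)"
        using p by (intro mult_right_mono exp_ge_add_one_self) auto
      finally have p1: "exp (- (2 * p)) \<le> 1 - p" by (simp add: exp_minus field_simps)
      have "real a * (2 * p) \<le> real n * p" using a p by (simp add: mult_right_mono)
      then have "exp (- (L / 6)) \<le> exp (- (real a * (2 * p)))" using np by simp
      also have "\<dots> = exp (- (2 * p)) ^ a" by (simp flip: exp_of_nat_mult)
      also have "\<dots> \<le> (1 - p) ^ a" using p1 by (intro power_mono) auto
      also have "\<dots> \<le> (1 - p) ^ (a - d)" using p by (intro power_decreasing) auto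
      finally have f1: "exp (- (L / 6)) \<le> (1 - p) ^ (a - d)" .
      \<comment> \<open>The successes cost at most \<open>exp (- (L / 4))\<close>: here
        \<open>a * p / d\<close> is at least \<open>1 / \<omega>\<close>, and
        \<open>d * ln \<omega> <= L / 4\<close>. Together both factors stay above
        \<open>exp (- (L / 2))\<close>.\<close>
      have "real d \<le> 2 / 5 * L" using dL L by simp
      also have "\<dots> = 2 / 5 * real n * (p * \<omega>)" using n0 p by (simp add: \<omega>_def)
      also have "\<dots> \<le> real a * (p * \<omega>)" using an p \<omega> by (intro mult_right_mono) auto
      finally have "inverse \<omega> \<le> real a / real d * p" using d(1) \<omega> by (simp add: field_simps)
      then have ap: "inverse \<omega> ^ d \<le> (real a / real d * p) ^ d" using \<omega> by (intro power_mono) auto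
      have "exp (- (L / 4)) \<le> exp (- (real d * W))" using dW by simp
      also have "\<dots> = inverse \<omega> ^ d" using \<omega> by (simp add: exp_minus W_def exp_of_nat_mult power_inverse)
      also have "\<dots> \<le> (real a / real d) ^ d * p ^ d" using ap by (simp only: power_mult_distrib)
      also have "\<dots> \<le> real (a choose d) * p ^ d"
        using da p binomial_ge_n_over_k_pow_k[of d a, where 'a = real] by (intro mult_right_mono) auto
      finally have f2: "exp (- (L / 4)) \<le> real (a choose d) * p ^ d" .
      have "exp (- (L / 2)) \<le> exp (- (L / 4)) * exp (- (L / 6))" using L by (simp flip: exp_add)
      also have "\<dots> \<le> (real (a choose d) * p ^ d) * (1 - p) ^ (a - d)"
        using f1 f2 p by (intro mult_mono) auto
      also have "\<dots> = measure_pmf.prob ?C {f. card {e\<in>B. f e} = d}"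
        using B p by (subst prob_coins_card_eq) auto
      also have "\<dots> \<le> measure_pmf.prob ?C {f. d \<le> card {e\<in>B. f e}}"
        by (intro measure_pmf.finite_measure_mono) auto
      finally show "exp (- (L / 2)) \<le> measure_pmf.prob ?C {f. d \<le> card {e\<in>B. f e}}" .
    next
      \<comment> \<open>There are at least \<open>3 / 4 * exp L\<close> blocks, so the expected
        number of successful ones is at least \<open>3 / 4 * exp (L / 2)\<close>, which exceeds 1 as
        \<open>L >= 9\<close>.\<close>
      have "6 * (3 / 2) \<le> y * W" using False W by (intro mult_mono) auto
      then have L9: "9 \<le> L" using Ly by simp
      have "3 / 4 * exp L \<le> real t" using tn n0 by (simp add: expL field_simps)
      then have "exp (- (L / 2)) * (3 / 4 * exp L) \<le> exp (- (L / 2)) * real t"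
        by (intro mult_left_mono) auto
      moreover have "exp (- (L / 2)) * (3 / 4 * exp L) = 3 / 4 * exp (L / 2)"
        by (simp flip: exp_add)
      moreover have "1 + L / 2 \<le> exp (L / 2)" by (rule exp_ge_add_one_self)
      moreover have "exp (- (L / 2)) * real t = real t * exp (- (L / 2))" by (rule mult.commute)
      ultimately have rt: "1 \<le> real t * exp (- (L / 2))" using L9 by linarith
      have "(1 - exp (- (L / 2))) ^ t \<le> exp (- exp (- (L / 2))) ^ t"
        using L exp_ge_add_one_self[of "- exp (- (L / 2))"] by (intro power_mono) auto
      also have "\<dots> = exp (- (real t * exp (- (L / 2))))" by (simp flip: exp_of_nat_mult)
      also have "\<dots> \<le> exp (- 1)" using rt by simp
      also have "\<dots> \<le> 1 / 2" using exp_ge_add_one_self[of 1] by (simp add: exp_minus field_simps)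
      finally show "1 / 2 \<le> 1 - (1 - exp (- (L / 2))) ^ t" by simp
    next
      have "1 / 75 * (y * real N) \<le> 3 / 16 * (y / 12 * real N)" using y0 by simp
      also have "\<dots> \<le> 3 / 16 * (real d * real N)" using d by (intro mult_left_mono mult_right_mono) auto
      finally show "1 / 75 * (y * real N) \<le> real d * (3 / 4 * (1 / 2 * (1 / 2 * real N)))" by simp
    qed simp
  qed
qed

subsection \<open>Upper bounds\<close>

text \<open>The estimate by 3 is too weak for the inequalities \<open>exp 2 <= 8\<close> and
  \<open>exp 9 <= 10 ^ 4\<close> needed below.\<close>

lemma exp_1_less: "exp 1 < (2719 / 1000 :: real)"
  using e_approx_32 by (simp add: abs_if split: if_splits)

text \<open>If the extremal number is too large, some pair of \<open>n\<close>-sets carries at least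
  \<open>x\<close> edges. The exponential factor bounds the number of pairs; the threshold
  \<open>x\<close> stays free so that each regime can balance it against this factor.\<close>

lemma ex_path_upper_tail:
  assumes n: "0 < n" "n \<le> N" and p: "0 \<le> p" "p \<le> 1"
    and x: "0 < x" "exp 1 * (3 / 2 * real n ^ 2) * p \<le> x"
  shows "measure_pmf.prob (gnp N p)
           {E. E \<subseteq> all_edges N \<and> (real N / real n + 1) * x < real (ex_path E (n + 1))}
         \<le> exp (2 * real n * (1 + ln (real N / real n))) * (exp 1 * (3 / 2 * real n ^ 2) * p / x) powr x"
proof -
  let ?C = "coins (all_edges N) p"
  define T where "T = {S. S \<subseteq> {..<N} \<and> card S = n}"
  define b where "b = (exp 1 * (3 / 2 * real n ^ 2) * p / x) powr x"
  have fT: "finite T" by (simp add: T_def)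
  have "real (card T) = real (N choose n)" by (simp add: T_def n_subsets)
  also have "\<dots> \<le> (exp 1 * real N / real n) ^ n" by (rule binomial_le_exp_power[OF n(1)])
  also have "exp 1 * real N / real n = exp (1 + ln (real N / real n))"
    using n by (simp add: exp_add)
  also have "\<dots> ^ n = exp (real n * (1 + ln (real N / real n)))" by (simp flip: exp_of_nat_mult)
  finally have cT: "real (card T) \<le> exp (real n * (1 + ln (real N / real n)))" .
  have "measure_pmf.prob (gnp N p)
      {E. E \<subseteq> all_edges N \<and> (real N / real n + 1) * x < real (ex_path E (n + 1))}
      \<le> measure_pmf.prob ?C (\<Union>(S, A)\<in>T \<times> T. {f. x \<le> real (card {e\<in>touching N S A. f e})})"
    unfolding measure_gnp
  proof (rule measure_pmf.finite_measure_mono, safe)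
    fix f assume lt: "(real N / real n + 1) * x < real (ex_path {e \<in> all_edges N. f e} (n + 1))"
    show "f \<in> (\<Union>(S, A)\<in>T \<times> T. {f. x \<le> real (card {e\<in>touching N S A. f e})})"
    proof (rule ccontr)
      assume not: "f \<notin> (\<Union>(S, A)\<in>T \<times> T. {f. x \<le> real (card {e\<in>touching N S A. f e})})"
      have "real (ex_path {e \<in> all_edges N. f e} (n + 1)) \<le> (real N / real n + 1) * x"
      proof (rule ex_path_le_blocks[OF n])
        fix S A assume "S \<subseteq> {..<N}" "A \<subseteq> {..<N}" "card S = n" "card A = n"
        then have "(S, A) \<in> T \<times> T" by (simp add: T_def)
        then have "real (card {e\<in>touching N S A. f e}) < x" using not by fastforce
        moreover have "{e \<in> all_edges N. f e} \<inter> touching N S A = {e\<in>touching N S A. f e}"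
          by (auto simp: touching_def)
        ultimately show "real (card ({e \<in> all_edges N. f e} \<inter> touching N S A)) \<le> x" by simp
      qed (use x in auto)
      then show False using lt by linarith
    qed
  qed simp
  also have "\<dots> \<le> (\<Sum>SA\<in>T \<times> T.
      measure_pmf.prob ?C (case SA of (S, A) \<Rightarrow> {f. x \<le> real (card {e\<in>touching N S A. f e})}))"
    using fT by (intro measure_pmf.finite_measure_subadditive_finite) auto
  also have "\<dots> \<le> (\<Sum>SA\<in>T \<times> T. b)"
  proof (rule sum_mono)
    fix SA assume "SA \<in> T \<times> T"
    then obtain S A where SA: "SA = (S, A)" "S \<in> T" "A \<in> T" by auto
    have "finite S" "finite A" using SA finite_subset by (auto simp: T_def)
    then have "real (card (touching N S A)) \<le> 3 / 2 * real n ^ 2"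
      using SA by (intro card_touching_le) (auto simp: T_def)
    then show "measure_pmf.prob ?C (case SA of (S, A) \<Rightarrow>
        {f. x \<le> real (card {e\<in>touching N S A. f e})}) \<le> b"
      unfolding SA(1) b_def prod.case using p x
      by (intro prob_coins_upper_tail) (auto simp: touching_def)
  qed
  also have "\<dots> = real (card T) * real (card T) * b"
    by (simp add: card_cartesian_product)
  also have "\<dots> \<le> exp (real n * (1 + ln (real N / real n))) * exp (real n * (1 + ln (real N / real n))) * b"
    using cT by (intro mult_right_mono mult_mono) (auto simp: b_def)
  also have "\<dots> = exp (2 * real n * (1 + ln (real N / real n))) * b"
    by (simp flip: exp_add)
  finally show ?thesis unfolding b_def .
qed

lemma one_le_sixtimes_mean:
  assumes n: "0 < n" and N: "3 * n \<le> (N::nat)" and pL: "ln (real N / real n) / (6 * real n) \<le> p"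
  shows "ln (real N / real n) \<le> 6 * (p * real n)" "1 \<le> 6 * (p * real n)"
proof -
  show "ln (real N / real n) \<le> 6 * (p * real n)"
    using pL n by (simp add: field_simps)
  then show "1 \<le> 6 * (p * real n)" using one_le_ln_ratio[OF n N] by linarith
qed

text \<open>For \<open>N >= 8 * n\<close> the extra block costs a factor at most
  \<open>9 / 8\<close>, and \<open>15 * 9 / 8 < 18\<close>. For smaller \<open>N\<close> there are
  at most \<open>4 * n * N\<close> pairs in all, so the total edge count is already unlikely to
  reach \<open>18 * p * n * N\<close>.\<close>

lemma ex_path_upper_dense:
  assumes n: "0 < n" and N: "3 * n \<le> N" and p: "0 < p" "p \<le> 1"
    and pL: "ln (real N / real n) / (6 * real n) \<le> p"
  shows "measure_pmf.prob (gnp N p)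
           {E. E \<subseteq> all_edges N \<and> 18 * p * real n * real N < real (ex_path E (n + 1))}
         \<le> exp (- (real n / 4))"
proof (cases "8 * n \<le> N")
  case True
  define L where "L = ln (real N / real n)"
  define x where "x = 15 * p * real n ^ 2"
  have x0: "0 < x" using n p by (simp add: x_def)
  have N0: "0 < real N" using n N by simp
  have tot: "(real N / real n + 1) * x \<le> 18 * p * real n * real N"
  proof -
    have "(real N / real n + 1) * x = 15 * (p * real n) * (real N + real n)"
      using n by (simp add: x_def power2_eq_square field_simps)
    also have "\<dots> \<le> 15 * (p * real n) * (9 / 8 * real N)"
      using True p by (intro mult_left_mono) auto
    also have "\<dots> \<le> 18 * p * real n * real N" using p by simp
    finally show ?thesis .
  qed
  have base: "exp 1 * (3 / 2 * real n ^ 2) * p / x = exp 1 / 10"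
    using n p by (simp add: x_def field_simps)
  have "exp 1 ^ 2 \<le> (2719 / 1000 :: real) ^ 2" using exp_1_less by (intro power_mono) auto
  also have "\<dots> \<le> 8" by (simp add: power2_eq_square)
  also have "8 \<le> real N / real n" using True n by (simp add: le_divide_eq)
  finally have "exp 2 \<le> real N / real n" by (simp flip: exp_of_nat_mult)
  then have L2: "2 \<le> L" using n N0 by (simp add: L_def ln_ge_iff)
  \<comment> \<open>The base is \<open>exp 1 / 10\<close>, so \<open>ln 10 >= 9 / 4\<close> yields
    decay at rate \<open>5 / 4\<close> in \<open>x\<close>. With \<open>x >= 5 / 2 * n * L\<close>
    and \<open>L >= 2\<close> this beats the union bound.\<close>
  have "exp (9 / 4) ^ 4 = exp (1::real) ^ 9" by (simp flip: exp_of_nat_mult)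
  also have "\<dots> \<le> (2719 / 1000) ^ 9" using exp_1_less by (intro power_mono) auto
  also have "\<dots> \<le> (10::real) ^ 4" by (simp add: power_numeral_reduce)
  finally have "exp (9 / 4) \<le> (10::real)" by (rule power_le_imp_le_base[of _ 3, simplified]) simp
  then have ln10: "9 / 4 \<le> ln (10::real)" by (subst ln_ge_iff) auto
  have "L \<le> 6 * (p * real n)" unfolding L_def by (rule one_le_sixtimes_mean[OF n N pL])
  then have "5 / 2 * real n * L \<le> 5 / 2 * real n * (6 * (p * real n))"
    by (intro mult_left_mono) auto
  then have x: "5 / 2 * (real n * L) \<le> x" by (simp add: x_def power2_eq_square mult_ac)
  have "measure_pmf.prob (gnp N p)
      {E. E \<subseteq> all_edges N \<and> 18 * p * real n * real N < real (ex_path E (n + 1))}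
      \<le> measure_pmf.prob (gnp N p)
      {E. E \<subseteq> all_edges N \<and> (real N / real n + 1) * x < real (ex_path E (n + 1))}"
    using tot by (intro measure_pmf.finite_measure_mono Collect_mono) auto
  also have "\<dots> \<le> exp (2 * real n * (1 + L)) * (exp 1 / 10) powr x"
    unfolding L_def base[symmetric]
  proof (rule ex_path_upper_tail)
    have "exp 1 * (3 / 2 * real n ^ 2) * p = exp 1 / 10 * x" using x0 by (simp flip: base)
    also have "\<dots> \<le> 1 * x" using exp_1_less x0 by (intro mult_right_mono) auto
    finally show "exp 1 * (3 / 2 * real n ^ 2) * p \<le> x" by simp
  qed (use n True p x0 in auto)
  also have "(exp 1 / 10 :: real) powr x = exp (x * (1 - ln 10))"
    by (simp add: powr_def ln_div)
  also have "\<dots> \<le> exp (5 / 2 * (real n * L) * - (5 / 4))"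
  proof -
    have "x * (5 / 4) \<le> x * (ln 10 - 1)" using ln10 x0 by (intro mult_left_mono) auto
    then have "x * (1 - ln 10) \<le> - (x * (5 / 4))" by (simp add: algebra_simps)
    then show ?thesis using x by simp
  qed
  also have "exp (2 * real n * (1 + L)) * exp (5 / 2 * (real n * L) * - (5 / 4)) =
      exp (2 * real n - 9 / 8 * (real n * L))"
    by (simp add: algebra_simps flip: exp_add)
  also have "\<dots> \<le> exp (- (real n / 4))"
    using mult_left_mono[OF L2, of "real n"] by simp
  finally show ?thesis by simp
next
  case False
  define x where "x = 18 * p * real n * real N"
  let ?C = "coins (all_edges N) p"
  have N0: "0 < real N" using n N by simp
  have x0: "0 < x" using n p N0 by (simp add: x_def)
  have nx: "real n \<le> x"
  proof -
    have "1 * real n \<le> 6 * (p * real n) * (3 * real N)"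
      using one_le_sixtimes_mean(2)[OF n N pL] N by (intro mult_mono) auto
    then show ?thesis by (simp add: x_def)
  qed
  have "card (all_edges N) \<le> N * N div 2"
    unfolding card_all_edges choose_two by (intro div_le_mono mult_le_mono) auto
  then have "2 * card (all_edges N) \<le> N * N" by linarith
  also have "\<dots> \<le> 8 * n * N" using False by simp
  finally have "real (2 * card (all_edges N)) \<le> real (8 * n * N)" by (rule of_nat_mono)
  then have cE: "real (card (all_edges N)) \<le> 4 * real n * real N" by (simp add: mult_ac)
  have base: "exp 1 * (4 * real n * real N) * p / x = exp 1 * 2 / 9"
    using n p N0 by (simp add: x_def field_simps)
  \<comment> \<open>The base is \<open>exp 1 / (9 / 2)\<close>, so this gives decay at rate
    \<open>1 / 4\<close> in \<open>x\<close>, and \<open>x >= n\<close>.\<close>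
  have "exp (5 / 4) ^ 4 = exp (1::real) ^ 5" by (simp flip: exp_of_nat_mult)
  also have "\<dots> \<le> (2719 / 1000) ^ 5" using exp_1_less by (intro power_mono) auto
  also have "\<dots> \<le> (9 / 2 :: real) ^ 4" by (simp add: power_numeral_reduce)
  finally have "exp (5 / 4) \<le> (9 / 2 :: real)" by (rule power_le_imp_le_base[of _ 3, simplified]) simp
  then have ln: "5 / 4 \<le> ln (9 / 2 :: real)" by (subst ln_ge_iff) auto
  have "measure_pmf.prob (gnp N p) {E. E \<subseteq> all_edges N \<and> x < real (ex_path E (n + 1))}
      \<le> measure_pmf.prob ?C {f. x \<le> real (card {e\<in>all_edges N. f e})}"
    unfolding measure_gnp
  proof (rule measure_pmf.finite_measure_mono, safe)
    fix f assume lt: "x < real (ex_path {e \<in> all_edges N. f e} (n + 1))"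
    obtain F where "F \<subseteq> {e \<in> all_edges N. f e}" "card F = ex_path {e \<in> all_edges N. f e} (n + 1)"
      using ex_path_witness[of "{e \<in> all_edges N. f e}" "n + 1"] n by auto
    then have "ex_path {e \<in> all_edges N. f e} (n + 1) \<le> card {e \<in> all_edges N. f e}"
      using card_mono[of "{e \<in> all_edges N. f e}" F] by simp
    then show "x \<le> real (card {e\<in>all_edges N. f e})" using lt by linarith
  qed simp
  also have "\<dots> \<le> (exp 1 * 2 / 9) powr x"
    unfolding base[symmetric]
  proof (rule prob_coins_upper_tail)
    have "exp 1 * (4 * real n * real N) * p = exp 1 * 2 / 9 * x" using x0 by (simp flip: base)
    also have "\<dots> \<le> 1 * x" using exp_1_less x0 by (intro mult_right_mono) auto
    finally show "exp 1 * (4 * real n * real N) * p \<le> x" by simp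
  qed (use p x0 cE in auto)
  also have "\<dots> = exp (x * (1 - ln (9 / 2)))"
    by (simp add: powr_def ln_div ln_mult)
  also have "\<dots> \<le> exp (- (real n / 4))"
  proof -
    have "x * (1 / 4) \<le> x * (ln (9 / 2) - 1)" using ln x0 by (intro mult_left_mono) auto
    then have "x * (1 - ln (9 / 2)) \<le> - (x / 4)" by (simp only: right_diff_distrib)
    then show ?thesis using nx by simp
  qed
  finally show ?thesis by (simp add: x_def)
qed

lemma ex_path_upper_sparse:
  fixes p :: real and n N :: nat
  defines "L \<equiv> ln (real N / real n)"
  defines "\<omega> \<equiv> L / (real n * p)"
  assumes n: "0 < n" and N: "3 * n \<le> N" and p: "0 < p" "p \<le> 1" "p \<le> L / (6 * real n)"
  shows "measure_pmf.prob (gnp N p)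
           {E. E \<subseteq> all_edges N \<and> 8 * (\<omega> / ln \<omega>) * p * real n * real N < real (ex_path E (n + 1))}
         \<le> exp (- (real n / 4))"
proof -
  define W where "W = ln \<omega>"
  \<comment> \<open>The correction for the extra block: \<open>N / n + 1 = c * N / n\<close>.
    Dividing by \<open>c\<close> in \<open>x\<close> makes the total exactly the claimed
    bound.\<close>
  define c where "c = 1 + real n / real N"
  define x where "x = 8 * real n * L / (W * c)"
  define b where "b = exp 1 / 4 * (W / \<omega>)"
  have N0: "0 < real N" using n N by simp
  have L: "1 \<le> L" unfolding L_def by (rule one_le_ln_ratio[OF n N])
  have np: "0 < real n * p" "6 * (real n * p) \<le> L" using p n by (auto simp: field_simps)
  have \<omega>: "6 \<le> \<omega>" using np by (simp add: \<omega>_def le_divide_eq)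
  then have W: "0 < W" by (simp add: W_def)
  have c: "1 \<le> c" "c \<le> 4 / 3" using N N0 by (auto simp: c_def field_simps)
  have x0: "0 < x" using n L W c by (simp add: x_def)
  have tot: "(real N / real n + 1) * x = 8 * (\<omega> / ln \<omega>) * p * real n * real N"
  proof -
    have "real N / real n + 1 = c * real N / real n" using n N0 by (simp add: c_def field_simps)
    moreover have "\<omega> / ln \<omega> * p * real n = L / W" using np by (simp add: \<omega>_def W_def)
    moreover have "c * real N / real n * x = 8 * (L / W) * real N"
      using n W c by (simp add: x_def)
    moreover have "8 * (\<omega> / ln \<omega>) * p * real n * real N = 8 * (\<omega> / ln \<omega> * p * real n) * real N"
      by simp
    ultimately show ?thesis by (simp only:)
  qed
  have bx: "exp 1 * (3 / 2 * real n ^ 2) * p / x \<le> b"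
  proof -
    have "exp 1 * (3 / 2 * real n ^ 2) * p / x = exp 1 * (3 / 16 * c) * (W / \<omega>)"
      using n L W c np by (simp add: x_def \<omega>_def field_simps power2_eq_square)
    also have "\<dots> \<le> exp 1 * (1 / 4) * (W / \<omega>)"
      using c W \<omega> by (intro mult_right_mono mult_left_mono) auto
    finally show ?thesis by (simp add: b_def)
  qed
  have b0: "0 < b" using W \<omega> by (simp add: b_def)
  \<comment> \<open>Bounding \<open>ln (W / 4)\<close> linearly leaves three quarters of
    \<open>- W\<close>. As \<open>c <= 4 / 3\<close>, the exponent \<open>x * ln b\<close> is then
    at most \<open>- 9 / 2 * n * L\<close>, which outweighs \<open>2 * n * (1 + L)\<close>.\<close>
  have lnb: "ln b \<le> - (3 / 4 * W)"
  proof -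
    have "ln b = 1 + ln (W / 4) - W"
      using W \<omega> by (simp add: b_def ln_mult ln_div W_def)
    also have "ln (W / 4) \<le> W / 4 - 1" using W by (intro ln_le_minus_one) simp
    finally show ?thesis by simp
  qed
  then have "ln b \<le> 0" using W by linarith
  then have b1: "b \<le> 1" using b0 by (simp add: ln_le_zero_iff)
  have "measure_pmf.prob (gnp N p)
      {E. E \<subseteq> all_edges N \<and> (real N / real n + 1) * x < real (ex_path E (n + 1))}
      \<le> exp (2 * real n * (1 + L)) * (exp 1 * (3 / 2 * real n ^ 2) * p / x) powr x"
    unfolding L_def
  proof (rule ex_path_upper_tail)
    have "exp 1 * (3 / 2 * real n ^ 2) * p / x \<le> 1" using bx b1 by linarith
    then show "exp 1 * (3 / 2 * real n ^ 2) * p \<le> x" using x0 by (simp add: divide_le_eq)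
  qed (use n N p x0 in auto)
  also have "\<dots> \<le> exp (2 * real n * (1 + L)) * b powr x"
    using bx x0 p by (intro mult_left_mono powr_mono2) auto
  also have "b powr x \<le> exp (- (9 / 2 * (real n * L)))"
  proof -
    have "x * ln b \<le> x * - (3 / 4 * W)" using lnb x0 by (intro mult_left_mono) auto
    also have "\<dots> = - (6 * (real n * L) / c)" using W c by (simp add: x_def field_simps)
    also have "\<dots> \<le> - (6 * (real n * L) / (4 / 3))"
      using c L by (intro le_imp_neg_le divide_left_mono) auto
    finally show ?thesis using b0 by (simp add: powr_def mult_ac)
  qed
  also have "exp (2 * real n * (1 + L)) * exp (- (9 / 2 * (real n * L))) =
      exp (2 * real n - 5 / 2 * (real n * L))"
    by (simp add: algebra_simps flip: exp_add)
  also have "\<dots> \<le> exp (- (real n / 4))"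
    using mult_left_mono[OF L, of "real n"] by simp
  finally show ?thesis unfolding tot by simp
qed

subsection \<open>The theorem\<close>

text \<open>This weakens the upper-tail error to the order \<open>1 / n\<close> of the Chebyshev
  error, so that both add up to \<open>104 / n\<close>.\<close>

lemma exp_minus_quarter_le:
  assumes "0 < n"
  shows "exp (- (real n / 4)) \<le> 4 / real n"
proof -
  have "real n / 4 \<le> exp (real n / 4)" using exp_ge_add_one_self[of "real n / 4"] by linarith
  then show ?thesis using assms by (simp add: exp_minus field_simps)
qed

text \<open>A random graph is almost surely a subset of \<open>all_edges N\<close>, so restricting
  the two tail events to such \<open>E\<close> costs nothing in the union bound.\<close>

lemma prob_ex_path_between:
  assumes "0 < n"
    and "measure_pmf.prob (gnp N p) {E. E \<subseteq> all_edges N \<and> real (ex_path E k) < lo} \<le> 100 / real n"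
    and "measure_pmf.prob (gnp N p) {E. E \<subseteq> all_edges N \<and> hi < real (ex_path E k)} \<le> exp (- (real n / 4))"
  shows "1 - 104 / real n \<le>
    measure_pmf.prob (gnp N p) {E. lo \<le> real (ex_path E k) \<and> real (ex_path E k) \<le> hi}"
proof -
  let ?P = "measure_pmf.prob (gnp N p)"
  let ?A = "{E. E \<subseteq> all_edges N \<and> real (ex_path E k) < lo}"
  let ?B = "{E. E \<subseteq> all_edges N \<and> hi < real (ex_path E k)}"
  let ?G = "{E. lo \<le> real (ex_path E k) \<and> real (ex_path E k) \<le> hi}"
  have "?P {E. E \<subseteq> all_edges N} = 1"
    unfolding measure_gnp by (simp add: measure_pmf.prob_space)
  moreover have "?P {E. E \<subseteq> all_edges N} \<le> ?P (?G \<union> (?A \<union> ?B))"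
    by (intro measure_pmf.finite_measure_mono) auto
  moreover have "?P (?G \<union> (?A \<union> ?B)) \<le> ?P ?G + ?P (?A \<union> ?B)" "?P (?A \<union> ?B) \<le> ?P ?A + ?P ?B"
    by (intro measure_Un_le; simp)+
  ultimately have "1 \<le> ?P ?G + (100 / real n + 4 / real n)"
    using assms(2,3) exp_minus_quarter_le[OF assms(1)] by linarith
  then show ?thesis by (simp add: add_divide_distrib[symmetric])
qed

lemma tendsto_one_if_eventually_ge:
  fixes f :: "nat \<Rightarrow> real"
  assumes "\<forall>\<^sub>F n in sequentially. 1 - c / real n \<le> f n" "\<And>n. f n \<le> 1"
  shows "f \<longlonglongrightarrow> 1"
proof (rule tendsto_sandwich[OF assms(1)])
  show "(\<lambda>n. 1 - c / real n) \<longlonglongrightarrow> 1"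
    using tendsto_diff[OF tendsto_const lim_const_over_n[of c], of 1] by simp
qed (use assms(2) in auto)

theorem theorem1p4:
  fixes N :: "nat \<Rightarrow> nat" and p :: "nat \<Rightarrow> real"
  assumes hN: "\<forall>\<^sub>F n in sequentially. 3 * n \<le> N n \<and> real (N n) \<le> real n * exp (2 * real n)"
      and hp: "\<forall>\<^sub>F n in sequentially. 0 < p n \<and> p n \<le> 1"
  shows
   "((\<forall>\<^sub>F n in sequentially. p n \<ge> ln (real (N n) / real n) / (6 * real n)) \<longrightarrow>
      ((\<lambda>n. measure_pmf.prob (gnp (N n) (p n))
          {E. 1/4 * p n * real n * real (N n) \<le> real (ex_path E (n + 1)) \<and>
              real (ex_path E (n + 1)) \<le> 18 * p n * real n * real (N n)}) \<longlonglongrightarrow> 1))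
    \<and>
    ((\<forall>\<^sub>F n in sequentially. 1 / real (N n) \<le> p n \<and>
                               p n \<le> ln (real (N n) / real n) / (6 * real n)) \<longrightarrow>
      (let \<omega> = (\<lambda>n. ln (real (N n) / real n) / (real n * p n)) in
      ((\<lambda>n. measure_pmf.prob (gnp (N n) (p n))
          {E. 1/75 * (\<omega> n / ln (\<omega> n)) * p n * real n * real (N n) \<le> real (ex_path E (n + 1)) \<and>
              real (ex_path E (n + 1)) \<le> 8 * (\<omega> n / ln (\<omega> n)) * p n * real n * real (N n)})
        \<longlonglongrightarrow> 1)))"
proof (intro conjI impI)
  assume "\<forall>\<^sub>F n in sequentially. p n \<ge> ln (real (N n) / real n) / (6 * real n)"
  \<comment> \<open>The threshold 10 comes from the two lower-bound lemmas.\<close>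
  with hN hp eventually_ge_at_top[of 10]
  have "\<forall>\<^sub>F n in sequentially. 1 - 104 / real n \<le> measure_pmf.prob (gnp (N n) (p n))
      {E. 1/4 * p n * real n * real (N n) \<le> real (ex_path E (n + 1)) \<and>
          real (ex_path E (n + 1)) \<le> 18 * p n * real n * real (N n)}"
  proof eventually_elim
    case (elim n)
    then show ?case
      by (intro prob_ex_path_between ex_path_lower_cliques ex_path_upper_dense) auto
  qed
  then show "(\<lambda>n. measure_pmf.prob (gnp (N n) (p n))
      {E. 1/4 * p n * real n * real (N n) \<le> real (ex_path E (n + 1)) \<and>
          real (ex_path E (n + 1)) \<le> 18 * p n * real n * real (N n)}) \<longlonglongrightarrow> 1"
    by (rule tendsto_one_if_eventually_ge) simp
next
  assume "\<forall>\<^sub>F n in sequentially. 1 / real (N n) \<le> p n \<and> p n \<le> ln (real (N n) / real n) / (6 * real n)"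
  with hN hp eventually_ge_at_top[of 10]
  have "\<forall>\<^sub>F n in sequentially. 1 - 104 / real n \<le> measure_pmf.prob (gnp (N n) (p n))
      {E. 1/75 * (ln (real (N n) / real n) / (real n * p n) / ln (ln (real (N n) / real n) / (real n * p n)))
            * p n * real n * real (N n) \<le> real (ex_path E (n + 1)) \<and>
          real (ex_path E (n + 1)) \<le>
            8 * (ln (real (N n) / real n) / (real n * p n) / ln (ln (real (N n) / real n) / (real n * p n)))
            * p n * real n * real (N n)}"
  proof eventually_elim
    case (elim n)
    then show ?case
      by (intro prob_ex_path_between ex_path_lower_sparse ex_path_upper_sparse) auto
  qed
  then show "let \<omega> = (\<lambda>n. ln (real (N n) / real n) / (real n * p n)) in
      (\<lambda>n. measure_pmf.prob (gnp (N n) (p n))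
        {E. 1/75 * (\<omega> n / ln (\<omega> n)) * p n * real n * real (N n) \<le> real (ex_path E (n + 1)) \<and>
            real (ex_path E (n + 1)) \<le> 8 * (\<omega> n / ln (\<omega> n)) * p n * real n * real (N n)})
      \<longlonglongrightarrow> 1"
    unfolding Let_def by (rule tendsto_one_if_eventually_ge) simp
qed

end
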